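(* Let $0\to(M,\alpha_M)\xrightarrow{t}(G,\alpha_G)\xrightarrow{p}(Q,\mathrm{Id}_Q)\to0$ be a split short exact sequence of $\alpha$-perfect Hom-Leibniz algebras with splitting homomorphism $s$, $p\circ s=\mathrm{Id}_Q$, and suppose the induced Hom-action of $Q$ on $M$, $q\cdot m=t^{-1}[s(q),t(m)]$, $m\cdot q=t^{-1}[t(m),s(q)]$, is symmetric: $q\cdot m+m\cdot q=0$. Let $\tau=\mathfrak{uce}_\alpha(t):\mathfrak{uce}_\alpha(M)\to\mathfrak{uce}_\alpha(G)$, $\sigma=\mathfrak{uce}_\alpha(s):\mathfrak{uce}(Q)\to\mathfrak{uce}_\alpha(G)$, $\sigma\{q_1,q_2\}=\{s(q_1),s(q_2)\}$, and $\pi=\mathfrak{uce}_\alpha(p)$. Then: 1. $\tau(\mathfrak{uce}_\alpha(M))=\mathrm{Ker}\,\pi$ is a two-sided Hom-ideal of $\mathfrak{uce}_\alpha(G)$, $\sigma(\mathfrak{uce}(Q))$ is a Hom-subalgebra on which $\overline{\alpha_G}$ is the identity, $\mathfrak{uce}_\alpha(G)=\tau(\mathfrak{uce}_\alpha(M))\oplus\sigma(\mathfrak{uce}(Q))$ as vector spaces, and $\mathfrak{uce}_\alpha(G)\cong\tau(\mathfrak{uce}_\alpha(M))\rtimes\sigma(\mathfrak{uce}(Q))$ with the Hom-action given by the bracket of $\mathfrak{uce}_\alpha(G)$. 2. $\sigma$ is an isomorphism of $(\mathfrak{uce}(Q),\mathrm{Id})$ onto $\sigma(\mathfrak{uce}(Q))$.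 3. $\mathrm{Ker}(U^G_\alpha)=\tau(\mathrm{Ker}\,U^M_\alpha)\oplus\sigma(HL_2(Q))$. 4. The formulas $\{q_1,q_2\}\cdot\{\alpha_M(m_1),\alpha_M(m_2)\}=\{[q_1,q_2]\cdot\alpha_M(m_1),\alpha_M^2(m_2)\}-\{[q_1,q_2]\cdot\alpha_M(m_2),\alpha_M^2(m_1)\}$ and $\{\alpha_M(m_1),\alpha_M(m_2)\}\cdot\{q_1,q_2\}=\{\alpha_M(m_1)\cdot[q_1,q_2],\alpha_M^2(m_2)\}-\{\alpha_M^2(m_1),[q_1,q_2]\cdot\alpha_M(m_2)\}$ define a Hom-action of $(\mathfrak{uce}(Q),\mathrm{Id})$ on $(\mathfrak{uce}_\alpha(M),\overline{\alpha_M})$; the map $\tau\rtimes\sigma:\mathfrak{uce}_\alpha(M)\rtimes\mathfrak{uce}(Q)\to\mathfrak{uce}_\alpha(G)$, $(x,y)\mapsto\tau(x)+\sigma(y)$, is a surjective homomorphism; and $\Phi:=U^G_\alpha\circ(\tau\rtimes\sigma)$, i.e. $\Phi(\{\alpha_M(m_1),\alpha_M(m_2)\},\{q_1,q_2\})=t[\alpha_M(m_1),\alpha_M(m_2)]+s[q_1,q_2]$, is a surjective homomorphism onto $(G,\alpha_G)$ with $\mathrm{Ker}\,\Phi=\mathrm{Ker}(U^M_\alpha)\oplus HL_2(Q)$. 5. $\mathrm{Ker}(\tau\rtimes\sigma)=\big(\mathfrak{uce}(Q)\cdot\mathrm{Ker}(U^M_\alpha)+\mathrm{Ker}(U^M_\alpha)\cdot\mathfrak{uce}(Q)\big)\oplus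 0$, where the products denote the spans of the actions above.
   Context: Hom-Leibniz algebras are multiplicative: $(L,\alpha_L)$ is a $\mathbb{K}$-vector space with bilinear bracket and linear $\alpha_L$ such that $[\alpha_L(x),[y,z]]=[[x,y],\alpha_L(z)]-[[x,z],\alpha_L(y)]$ and $\alpha_L[x,y]=[\alpha_L(x),\alpha_L(y)]$; homomorphisms preserve brackets and commute with structure maps. $(L,\alpha_L)$ is $\alpha$-perfect if $L=[\alpha_L(L),\alpha_L(L)]$ (for $(Q,\mathrm{Id}_Q)$ this means $Q=[Q,Q]$). A Hom-action of $(L,\alpha_L)$ on $(M,\alpha_M)$ is a pair of bilinear maps $x\otimes m\mapsto x\cdot m$, $m\otimes x\mapsto m\cdot x$ with, for all $x,y\in L$, $m,m'\in M$: $\alpha_M(m)\cdot[x,y]=(m\cdot x)\cdot\alpha_L(y)-(m\cdot y)\cdot\alpha_L(x)$; $\alpha_L(x)\cdot(m\cdot y)=(x\cdot m)\cdot\alpha_L(y)-[x,y]\cdot\alpha_M(m)$; $\alpha_L(x)\cdot(y\cdot m)=[x,y]\cdot\alpha_M(m)-(x\cdot m)\cdot\alpha_L(y)$; $\alpha_L(x)\cdot[m,m']=[x\cdot m,\alpha_M(m')]-[x\cdot m',\alpha_M(m)]$; $[\alpha_M(m),m'\cdot x]=[m,m']\cdot\alpha_L(x)-[m\cdot x,\alpha_M(m')]$; $[\alpha_M(m),x\cdot m']=[m\cdot x,\alpha_M(m')]-[m,m']\cdot\alpha_L(x)$; $\alpha_M(x\cdot m)=\alpha_L(x)\cdot\alpha_M(m)$;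 $\alpha_M(m\cdot x)=\alpha_M(m)\cdot\alpha_L(x)$. The semi-direct product $M\rtimes L$ is $M\oplus L$ with $\widetilde\alpha(m,l)=(\alpha_M(m),\alpha_L(l))$ and $[(m_1,l_1),(m_2,l_2)]=([m_1,m_2]+\alpha_L(l_1)\cdot m_2+m_1\cdot\alpha_L(l_2),[l_1,l_2])$. For $\alpha$-perfect $(L,\alpha_L)$: $I_L\subseteq\alpha_L(L)\otimes\alpha_L(L)$ is spanned by $-[x_1,x_2]\otimes\alpha_L(x_3)+[x_1,x_3]\otimes\alpha_L(x_2)+\alpha_L(x_1)\otimes[x_2,x_3]$; $\mathfrak{uce}_\alpha(L)=(\alpha_L(L)\otimes\alpha_L(L))/I_L$ with classes $\{\alpha_L(x_1),\alpha_L(x_2)\}$, bracket $[\{a,b\},\{c,e\}]=\{[a,b],[c,e]\}$, endomorphism $\overline{\alpha_L}\{\alpha_L(x_1),\alpha_L(x_2)\}=\{\alpha_L^2(x_1),\alpha_L^2(x_2)\}$, and $U^L_\alpha\{a,b\}=[a,b]$, the universal $\alpha$-central extension of $L$. For $Q$ with $\mathrm{Id}_Q$ this gives $\mathfrak{uce}(Q)=(Q\otimes Q)/I_Q$ with identity endomorphism, $u_Q\{q_1,q_2\}=[q_1,q_2]$, and $HL_2(Q)=\mathrm{Ker}\,u_Q$. For a homomorphism $g$, $\mathfrak{uce}_\alpha(g)\{\alpha(x_1),\alpha(x_2)\}=\{\alpha(g(x_1)),\alpha(g(x_2))\}$. *)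

theory Defs
  imports Main
begin

record ('k, 'a) hla =
  carr :: "'a set"
  zer  :: 'a
  pls  :: "'a \<Rightarrow> 'a \<Rightarrow> 'a"
  smul :: "'k \<Rightarrow> 'a \<Rightarrow> 'a"
  brk  :: "'a \<Rightarrow> 'a \<Rightarrow> 'a"
  alp  :: "'a \<Rightarrow> 'a"

definition neg :: "('k::field, 'a) hla \<Rightarrow> 'a \<Rightarrow> 'a" where
  "neg V x = smul V (-1) x"

definition mns :: "('k::field, 'a) hla \<Rightarrow> 'a \<Rightarrow> 'a \<Rightarrow> 'a" where
  "mns V x y = pls V x (neg V y)"

definition vs :: "('k::field, 'a) hla \<Rightarrow> bool" where
  "vs V \<longleftrightarrow>
     zer V \<in> carr V \<and>
     (\<forall>x\<in>carr V. \<forall>y\<in>carr V. pls V x y \<in> carr V) \<and>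
     (\<forall>c. \<forall>x\<in>carr V. smul V c x \<in> carr V) \<and>
     (\<forall>x\<in>carr V. \<forall>y\<in>carr V. \<forall>z\<in>carr V. pls V (pls V x y) z = pls V x (pls V y z)) \<and>
     (\<forall>x\<in>carr V. \<forall>y\<in>carr V. pls V x y = pls V y x) \<and>
     (\<forall>x\<in>carr V. pls V x (zer V) = x) \<and>
     (\<forall>x\<in>carr V. pls V x (neg V x) = zer V) \<and>
     (\<forall>a. \<forall>x\<in>carr V. \<forall>y\<in>carr V. smul V a (pls V x y) = pls V (smul V a x) (smul V a y)) \<and>
     (\<forall>a b. \<forall>x\<in>carr V. smul V (a + b) x = pls V (smul V a x) (smul V b x)) \<and>
     (\<forall>a b. \<forall>x\<in>carr V. smul V (a * b) x = smul V a (smul V b x)) \<and>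
     (\<forall>x\<in>carr V. smul V 1 x = x)"

definition lin :: "('a \<Rightarrow> 'b) \<Rightarrow> ('k::field, 'a) hla \<Rightarrow> ('k, 'b) hla \<Rightarrow> bool" where
  "lin f V W \<longleftrightarrow>
     (\<forall>x\<in>carr V. f x \<in> carr W) \<and>
     (\<forall>x\<in>carr V. \<forall>y\<in>carr V. f (pls V x y) = pls W (f x) (f y)) \<and>
     (\<forall>c. \<forall>x\<in>carr V. f (smul V c x) = smul W c (f x))"

definition hom_leibniz :: "('k::field, 'a) hla \<Rightarrow> bool" where
  "hom_leibniz L \<longleftrightarrow> vs L \<and>
     (\<forall>x\<in>carr L. lin (brk L x) L L) \<and>
     (\<forall>y\<in>carr L. lin (\<lambda>x. brk L x y) L L) \<and>
     lin (alp L) L L \<and>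
     (\<forall>x\<in>carr L. \<forall>y\<in>carr L. \<forall>z\<in>carr L.
        brk L (alp L x) (brk L y z) =
        mns L (brk L (brk L x y) (alp L z)) (brk L (brk L x z) (alp L y))) \<and>
     (\<forall>x\<in>carr L. \<forall>y\<in>carr L. alp L (brk L x y) = brk L (alp L x) (alp L y))"

inductive_set span_in :: "('k::field, 'a) hla \<Rightarrow> 'a set \<Rightarrow> 'a set"
  for V :: "('k, 'a) hla" and S :: "'a set" where
  span_zero: "zer V \<in> span_in V S"
| span_base: "x \<in> S \<Longrightarrow> x \<in> span_in V S"
| span_add: "x \<in> span_in V S \<Longrightarrow> y \<in> span_in V S \<Longrightarrow> pls V x y \<in> span_in V S"
| span_smul: "x \<in> span_in V S \<Longrightarrow> smul V c x \<in> span_in V S"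

definition alpha_perfect :: "('k::field, 'a) hla \<Rightarrow> bool" where
  "alpha_perfect L \<longleftrightarrow>
     carr L = span_in L {brk L (alp L x) (alp L y) | x y. x \<in> carr L \<and> y \<in> carr L}"

definition hom :: "('a \<Rightarrow> 'b) \<Rightarrow> ('k::field, 'a) hla \<Rightarrow> ('k, 'b) hla \<Rightarrow> bool" where
  "hom f L1 L2 \<longleftrightarrow> lin f L1 L2 \<and>
     (\<forall>x\<in>carr L1. \<forall>y\<in>carr L1. f (brk L1 x y) = brk L2 (f x) (f y)) \<and>
     (\<forall>x\<in>carr L1. f (alp L1 x) = alp L2 (f x))"

definition iso :: "('a \<Rightarrow> 'b) \<Rightarrow> ('k::field, 'a) hla \<Rightarrow> ('k, 'b) hla \<Rightarrow> bool" where
  "iso f L1 L2 \<longleftrightarrow> hom f L1 L2 \<and> bij_betw f (carr L1) (carr L2)"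

definition ker :: "('a \<Rightarrow> 'b) \<Rightarrow> ('k::field, 'a) hla \<Rightarrow> ('k, 'b) hla \<Rightarrow> 'a set" where
  "ker f L1 L2 = {x \<in> carr L1. f x = zer L2}"

definition restr :: "('k, 'a) hla \<Rightarrow> 'a set \<Rightarrow> ('k, 'a) hla" where
  "restr L A = L\<lparr>carr := A\<rparr>"

definition subspace :: "('k::field, 'a) hla \<Rightarrow> 'a set \<Rightarrow> bool" where
  "subspace V A \<longleftrightarrow> A \<subseteq> carr V \<and> zer V \<in> A \<and>
     (\<forall>x\<in>A. \<forall>y\<in>A. pls V x y \<in> A) \<and> (\<forall>c. \<forall>x\<in>A. smul V c x \<in> A)"

definition hom_subalgebra :: "('k::field, 'a) hla \<Rightarrow> 'a set \<Rightarrow> bool" where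
  "hom_subalgebra L A \<longleftrightarrow> subspace L A \<and> alp L ` A \<subseteq> A \<and>
     (\<forall>x\<in>A. \<forall>y\<in>A. brk L x y \<in> A)"

definition hom_ideal :: "('k::field, 'a) hla \<Rightarrow> 'a set \<Rightarrow> bool" where
  "hom_ideal L I \<longleftrightarrow> subspace L I \<and> alp L ` I \<subseteq> I \<and>
     (\<forall>x\<in>I. \<forall>y\<in>carr L. brk L x y \<in> I \<and> brk L y x \<in> I)"

definition dsum :: "('k::field, 'a) hla \<Rightarrow> 'a set \<Rightarrow> 'a set \<Rightarrow> 'a set \<Rightarrow> bool" where
  "dsum V A B C \<longleftrightarrow> C = {pls V a b | a b. a \<in> A \<and> b \<in> B} \<and> A \<inter> B = {zer V}"

definition hom_action :: "('k::field, 'l) hla \<Rightarrow> ('k, 'm) hla \<Rightarrow>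
    ('l \<Rightarrow> 'm \<Rightarrow> 'm) \<Rightarrow> ('m \<Rightarrow> 'l \<Rightarrow> 'm) \<Rightarrow> bool" where
  "hom_action L M al ar \<longleftrightarrow>
     (\<forall>x\<in>carr L. lin (al x) M M \<and> lin (\<lambda>m. ar m x) M M) \<and>
     (\<forall>m\<in>carr M. lin (\<lambda>x. al x m) L M \<and> lin (ar m) L M) \<and>
     (\<forall>x\<in>carr L. \<forall>y\<in>carr L. \<forall>m\<in>carr M.
        ar (alp M m) (brk L x y) = mns M (ar (ar m x) (alp L y)) (ar (ar m y) (alp L x)) \<and>
        al (alp L x) (ar m y) = mns M (ar (al x m) (alp L y)) (al (brk L x y) (alp M m)) \<and>
        al (alp L x) (al y m) = mns M (al (brk L x y) (alp M m)) (ar (al x m) (alp L y))) \<and>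
     (\<forall>x\<in>carr L. \<forall>m\<in>carr M. \<forall>m'\<in>carr M.
        al (alp L x) (brk M m m') = mns M (brk M (al x m) (alp M m')) (brk M (al x m') (alp M m)) \<and>
        brk M (alp M m) (ar m' x) = mns M (ar (brk M m m') (alp L x)) (brk M (ar m x) (alp M m')) \<and>
        brk M (alp M m) (al x m') = mns M (brk M (ar m x) (alp M m')) (ar (brk M m m') (alp L x))) \<and>
     (\<forall>x\<in>carr L. \<forall>m\<in>carr M.
        alp M (al x m) = al (alp L x) (alp M m) \<and> alp M (ar m x) = ar (alp M m) (alp L x))"

definition sdp :: "('k::field, 'm) hla \<Rightarrow> ('k, 'l) hla \<Rightarrow>
    ('l \<Rightarrow> 'm \<Rightarrow> 'm) \<Rightarrow> ('m \<Rightarrow> 'l \<Rightarrow> 'm) \<Rightarrow> ('k, 'm \<times> 'l) hla" where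
  "sdp M L al ar =
    \<lparr> carr = carr M \<times> carr L,
      zer = (zer M, zer L),
      pls = (\<lambda>(m1, l1) (m2, l2). (pls M m1 m2, pls L l1 l2)),
      smul = (\<lambda>c (m, l). (smul M c m, smul L c l)),
      brk = (\<lambda>(m1, l1) (m2, l2).
               (pls M (pls M (brk M m1 m2) (al (alp L l1) m2)) (ar m1 (alp L l2)), brk L l1 l2)),
      alp = (\<lambda>(m, l). (alp M m, alp L l)) \<rparr>"

section \<open>The universal alpha-central extension uce_alpha(L) = (alpha(L) \<otimes> alpha(L)) / I_L\<close>

text \<open>The free vector space on alpha(L) \<times> alpha(L): finitely supported functions.\<close>
definition supp :: "('b \<Rightarrow> 'k::zero) \<Rightarrow> 'b set" where
  "supp f = {z. f z \<noteq> 0}"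

definition delta :: "'b \<Rightarrow> 'b \<Rightarrow> 'k::{zero,one}" where
  "delta p = (\<lambda>z. if z = p then 1 else 0)"

definition fadd :: "('b \<Rightarrow> 'k::field) \<Rightarrow> ('b \<Rightarrow> 'k) \<Rightarrow> 'b \<Rightarrow> 'k" where
  "fadd f g = (\<lambda>z. f z + g z)"

definition fsmul :: "'k::field \<Rightarrow> ('b \<Rightarrow> 'k) \<Rightarrow> 'b \<Rightarrow> 'k" where
  "fsmul c f = (\<lambda>z. c * f z)"

definition fsub :: "('b \<Rightarrow> 'k::field) \<Rightarrow> ('b \<Rightarrow> 'k) \<Rightarrow> 'b \<Rightarrow> 'k" where
  "fsub f g = (\<lambda>z. f z - g z)"

text \<open>Linear extension of a map on basis elements.\<close>
definition push :: "('b \<Rightarrow> 'c) \<Rightarrow> ('b \<Rightarrow> 'k::field) \<Rightarrow> 'c \<Rightarrow> 'k" where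
  "push \<phi> f = (\<lambda>z. \<Sum>p\<in>{p \<in> supp f. \<phi> p = z}. f p)"

text \<open>Bilinear extension of  [{a,b},{c,e}] = {[a,b],[c,e]}.\<close>
definition fbr :: "('k::field, 'a) hla \<Rightarrow> ('a \<times> 'a \<Rightarrow> 'k) \<Rightarrow> ('a \<times> 'a \<Rightarrow> 'k) \<Rightarrow> 'a \<times> 'a \<Rightarrow> 'k" where
  "fbr L f g = (\<lambda>z. \<Sum>p\<in>supp f. \<Sum>q\<in>supp g.
      if (brk L (fst p) (snd p), brk L (fst q) (snd q)) = z then f p * g q else 0)"

definition FL :: "('k::field, 'a) hla \<Rightarrow> ('a \<times> 'a \<Rightarrow> 'k) set" where
  "FL L = {f. finite (supp f) \<and> supp f \<subseteq> alp L ` carr L \<times> alp L ` carr L}"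

definition freeV :: "('k::field, 'a) hla \<Rightarrow> ('k, 'a \<times> 'a \<Rightarrow> 'k) hla" where
  "freeV L = \<lparr> carr = FL L, zer = (\<lambda>_. 0), pls = fadd, smul = fsmul,
               brk = fbr L, alp = push (map_prod (alp L) (alp L)) \<rparr>"

text \<open>Bilinearity relations (defining the tensor product alpha(L) \<otimes> alpha(L)).\<close>
definition Rbil :: "('k::field, 'a) hla \<Rightarrow> ('a \<times> 'a \<Rightarrow> 'k) set" where
  "Rbil L = (let A = alp L ` carr L in
     {fsub (fsub (delta (pls L a a', b)) (delta (a, b))) (delta (a', b)) | a a' b. a \<in> A \<and> a' \<in> A \<and> b \<in> A}
   \<union> {fsub (fsub (delta (a, pls L b b')) (delta (a, b))) (delta (a, b')) | a b b'. a \<in> A \<and> b \<in> A \<and> b' \<in> A}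
   \<union> {fsub (delta (smul L c a, b)) (fsmul c (delta (a, b))) | c a b. a \<in> A \<and> b \<in> A}
   \<union> {fsub (delta (a, smul L c b)) (fsmul c (delta (a, b))) | c a b. a \<in> A \<and> b \<in> A})"

definition IL :: "('k::field, 'a) hla \<Rightarrow> ('a \<times> 'a \<Rightarrow> 'k) set" where
  "IL L = {fadd (fadd (fsmul (-1) (delta (brk L x1 x2, alp L x3)))
                       (delta (brk L x1 x3, alp L x2)))
                 (delta (alp L x1, brk L x2 x3))
           | x1 x2 x3. x1 \<in> carr L \<and> x2 \<in> carr L \<and> x3 \<in> carr L}"

definition NL :: "('k::field, 'a) hla \<Rightarrow> ('a \<times> 'a \<Rightarrow> 'k) set" where
  "NL L = span_in (freeV L) (Rbil L \<union> IL L)"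

definition cls :: "('k::field, 'a) hla \<Rightarrow> ('a \<times> 'a \<Rightarrow> 'k) \<Rightarrow> ('a \<times> 'a \<Rightarrow> 'k) set" where
  "cls L f = {g \<in> FL L. fsub g f \<in> NL L}"

definition rep :: "'b set \<Rightarrow> 'b" where
  "rep X = (SOME f. f \<in> X)"

definition uce :: "('k::field, 'a) hla \<Rightarrow> ('k, ('a \<times> 'a \<Rightarrow> 'k) set) hla" where
  "uce L = \<lparr> carr = cls L ` FL L,
             zer = cls L (\<lambda>_. 0),
             pls = (\<lambda>X Y. cls L (fadd (rep X) (rep Y))),
             smul = (\<lambda>c X. cls L (fsmul c (rep X))),
             brk = (\<lambda>X Y. cls L (fbr L (rep X) (rep Y))),
             alp = (\<lambda>X. cls L (push (map_prod (alp L) (alp L)) (rep X))) \<rparr>"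

definition gen :: "('k::field, 'a) hla \<Rightarrow> 'a \<Rightarrow> 'a \<Rightarrow> ('a \<times> 'a \<Rightarrow> 'k) set" where
  "gen L a b = cls L (delta (a, b))"

definition uce_map :: "('a \<Rightarrow> 'b) \<Rightarrow> ('k::field, 'a) hla \<Rightarrow> ('k, 'b) hla \<Rightarrow>
    ('a \<times> 'a \<Rightarrow> 'k) set \<Rightarrow> ('b \<times> 'b \<Rightarrow> 'k) set" where
  "uce_map g L1 L2 X = cls L2 (push (map_prod g g) (rep X))"

fun vsuml :: "('k, 'a) hla \<Rightarrow> 'a list \<Rightarrow> 'a" where
  "vsuml V [] = zer V"
| "vsuml V (x # xs) = pls V x (vsuml V xs)"

definition vsum :: "('k, 'a) hla \<Rightarrow> ('b \<Rightarrow> 'a) \<Rightarrow> 'b set \<Rightarrow> 'a" where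
  "vsum V g A = vsuml V (map g (SOME xs. distinct xs \<and> set xs = A))"

definition Uce :: "('k::field, 'a) hla \<Rightarrow> ('a \<times> 'a \<Rightarrow> 'k) set \<Rightarrow> 'a" where
  "Uce L X = vsum L (\<lambda>p. smul L (rep X p) (brk L (fst p) (snd p))) (supp (rep X))"

text \<open>HL_2(Q) = Ker u_Q (for (Q, Id_Q), uce_alpha(Q) is uce(Q) with identity endomorphism).\<close>
definition HL2 :: "('k::field, 'a) hla \<Rightarrow> ('a \<times> 'a \<Rightarrow> 'k) set set" where
  "HL2 Q = ker (Uce Q) (uce Q) Q"

definition ind_l :: "('k::field, 'm) hla \<Rightarrow> ('k, 'g) hla \<Rightarrow> ('m \<Rightarrow> 'g) \<Rightarrow> ('q \<Rightarrow> 'g) \<Rightarrow> 'q \<Rightarrow> 'm \<Rightarrow> 'm" where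
  "ind_l M G t s q m = the_inv_into (carr M) t (brk G (s q) (t m))"

definition ind_r :: "('k::field, 'm) hla \<Rightarrow> ('k, 'g) hla \<Rightarrow> ('m \<Rightarrow> 'g) \<Rightarrow> ('q \<Rightarrow> 'g) \<Rightarrow> 'm \<Rightarrow> 'q \<Rightarrow> 'm" where
  "ind_r M G t s m q = the_inv_into (carr M) t (brk G (t m) (s q))"

end

(* Since an alpha-perfect algebra has surjective alpha, uce L is a quotient of L (x) L with the
   universal property for bilinear maps b satisfying
   b(alpha x, [y,z]) = b([x,y], alpha z) - b([x,z], alpha y),
   and its bracket is [X,Y] = {U X, U Y}. As linear functionals separate points from subspaces,
   identities in uce L are checked with values in the ground field.

   The relation and perfectness of M put all mixed generators {t m, s q} and {s q, t m} into the image
   of tau, so uce G = tau(uce M) + sigma(uce Q), and pi splits off the second summand. For the kernel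
   of tau, let K be spanned by the action on Ker(U_M). Every functional on uce M / K extends
   along tau to uce G: the values forced on mixed generators are well defined modulo K, and
   compatibility with the relation amounts, argument by argument in M or Q, to the Hom-action axioms. *)
theory Submission
  imports Defs
begin

text \<open>The operations of \<open>uce\<close> act on representatives picked by
  \<open>rep\<close>, and \<open>Uce\<close> sums along a chosen enumeration of a support, so
  neither can be computed directly. A functional turns both into the plain sum \<open>ext\<close>
  over the field, and independence of all choices comes down to one fact: scalar forms compatible
  with the relations vanish on \<open>NL L\<close>. The relation rewrites {x, [y, z]} only when x
  carries an \<alpha>. This is where the identity on Q matters: s q = \<alpha>(s q), so {s q,
  [t m, t n]} and {[t m, t n], s q} can both be rewritten. Symmetry leaves a single operator D q on
  M, but the Leibniz identity of G gives two expressions for D q [m, n], according to the place of s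
  q. Lifted to \<open>uce M\<close> they become two formulas, \<open>actl\<close> and
  \<open>actr\<close>, and nothing in the proof makes one the negative of the other. Hence both
  enter K. When a functional is extended to \<open>uce G\<close>, its values on {s q, s q'} are not
  forced; they are taken to be 0.\<close>

section \<open>Vector spaces and subspaces given by records\<close>

lemma vs_zer [simp]: "vs V \<Longrightarrow> zer V \<in> carr V"
  unfolding vs_def by meson

lemma vs_pls [simp]: "vs V \<Longrightarrow> x \<in> carr V \<Longrightarrow> y \<in> carr V \<Longrightarrow> pls V x y \<in> carr V"
  unfolding vs_def by meson

lemma vs_smul [simp]: "vs V \<Longrightarrow> x \<in> carr V \<Longrightarrow> smul V c x \<in> carr V"
  unfolding vs_def by meson

lemma vs_neg [simp]: "vs V \<Longrightarrow> x \<in> carr V \<Longrightarrow> neg V x \<in> carr V"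
  by (simp add: neg_def)

lemma vs_mns [simp]: "vs V \<Longrightarrow> x \<in> carr V \<Longrightarrow> y \<in> carr V \<Longrightarrow> mns V x y \<in> carr V"
  by (simp add: mns_def)

lemma pls_assoc: "vs V \<Longrightarrow> x \<in> carr V \<Longrightarrow> y \<in> carr V \<Longrightarrow> z \<in> carr V \<Longrightarrow>
    pls V (pls V x y) z = pls V x (pls V y z)"
  unfolding vs_def by meson

lemma pls_comm: "vs V \<Longrightarrow> x \<in> carr V \<Longrightarrow> y \<in> carr V \<Longrightarrow> pls V x y = pls V y x"
  unfolding vs_def by meson

lemma pls_lcomm: "vs V \<Longrightarrow> x \<in> carr V \<Longrightarrow> y \<in> carr V \<Longrightarrow> z \<in> carr V \<Longrightarrow>
    pls V x (pls V y z) = pls V y (pls V x z)"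
  by (metis pls_assoc pls_comm)

lemmas pls_ac = pls_assoc pls_comm pls_lcomm

lemma pls_zer [simp]: "vs V \<Longrightarrow> x \<in> carr V \<Longrightarrow> pls V x (zer V) = x"
  unfolding vs_def by meson

lemma zer_pls [simp]: "vs V \<Longrightarrow> x \<in> carr V \<Longrightarrow> pls V (zer V) x = x"
  by (metis pls_comm pls_zer vs_zer)

lemma pls_neg [simp]: "vs V \<Longrightarrow> x \<in> carr V \<Longrightarrow> pls V x (neg V x) = zer V"
  unfolding vs_def by meson

lemma smul_pls: "vs V \<Longrightarrow> x \<in> carr V \<Longrightarrow> y \<in> carr V \<Longrightarrow>
    smul V a (pls V x y) = pls V (smul V a x) (smul V a y)"
  unfolding vs_def by meson

lemma smul_add: "vs V \<Longrightarrow> x \<in> carr V \<Longrightarrow> smul V (a + b) x = pls V (smul V a x) (smul V b x)"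
  unfolding vs_def by meson

lemma smul_smul: "vs V \<Longrightarrow> x \<in> carr V \<Longrightarrow> smul V a (smul V b x) = smul V (a * b) x"
  unfolding vs_def by metis

lemma smul_one [simp]: "vs V \<Longrightarrow> x \<in> carr V \<Longrightarrow> smul V 1 x = x"
  unfolding vs_def by meson

lemma smul_zero [simp]: "vs V \<Longrightarrow> x \<in> carr V \<Longrightarrow> smul V 0 x = zer V"
  using smul_add[of V x 1 "-1"] by (simp flip: neg_def)

lemma smul_zer [simp]: "vs V \<Longrightarrow> smul V c (zer V) = zer V"
  using smul_smul[of V "zer V" c 0] by simp

lemma mns_eq_zer: "vs V \<Longrightarrow> x \<in> carr V \<Longrightarrow> y \<in> carr V \<Longrightarrow> mns V x y = zer V \<Longrightarrow> x = y"
  by (metis mns_def pls_assoc pls_comm pls_neg pls_zer vs_neg zer_pls)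

lemma subspace_carr: "subspace V A \<Longrightarrow> x \<in> A \<Longrightarrow> x \<in> carr V"
  by (auto simp: subspace_def)

lemma subspace_mns: "subspace V A \<Longrightarrow> x \<in> A \<Longrightarrow> y \<in> A \<Longrightarrow> mns V x y \<in> A"
  by (auto simp: subspace_def mns_def neg_def)

lemma span_in_subset: "subspace V A \<Longrightarrow> B \<subseteq> A \<Longrightarrow> span_in V B \<subseteq> A"
proof
  fix x assume A: "subspace V A" "B \<subseteq> A" and "x \<in> span_in V B"
  from this(3) show "x \<in> A" by induction (use A in \<open>auto simp: subspace_def\<close>)
qed

lemma subspace_carrier: "vs V \<Longrightarrow> subspace V (carr V)"
  by (simp add: subspace_def)

lemma subspace_span: "vs V \<Longrightarrow> B \<subseteq> carr V \<Longrightarrow> subspace V (span_in V B)"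
  using span_in_subset[OF subspace_carrier, of V B]
  by (auto simp: subspace_def intro: span_in.intros)

section \<open>Linear maps relative to carriers\<close>

lemma linI:
  assumes "\<And>x. x \<in> carr V \<Longrightarrow> f x \<in> carr W"
    and "\<And>x y. x \<in> carr V \<Longrightarrow> y \<in> carr V \<Longrightarrow> f (pls V x y) = pls W (f x) (f y)"
    and "\<And>c x. x \<in> carr V \<Longrightarrow> f (smul V c x) = smul W c (f x)"
  shows "lin f V W"
  using assms by (simp add: lin_def)

lemma lin_closed: "lin f V W \<Longrightarrow> x \<in> carr V \<Longrightarrow> f x \<in> carr W"
  by (simp add: lin_def)

lemma lin_pls: "lin f V W \<Longrightarrow> x \<in> carr V \<Longrightarrow> y \<in> carr V \<Longrightarrow> f (pls V x y) = pls W (f x) (f y)"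
  by (simp add: lin_def)

lemma lin_smul: "lin f V W \<Longrightarrow> x \<in> carr V \<Longrightarrow> f (smul V c x) = smul W c (f x)"
  by (simp add: lin_def)

lemma lin_neg: "lin f V W \<Longrightarrow> x \<in> carr V \<Longrightarrow> f (neg V x) = neg W (f x)"
  by (simp add: neg_def lin_smul)

lemma lin_mns: "lin f V W \<Longrightarrow> vs V \<Longrightarrow> x \<in> carr V \<Longrightarrow> y \<in> carr V \<Longrightarrow> f (mns V x y) = mns W (f x) (f y)"
  by (simp add: mns_def lin_neg lin_pls)

lemma lin_zer: "lin f V W \<Longrightarrow> vs V \<Longrightarrow> vs W \<Longrightarrow> f (zer V) = zer W"
  using lin_smul[of f V W "zer V" 0] lin_closed[of f V W "zer V"] by simp

lemmas lin_simps = lin_closed lin_pls lin_smul lin_neg lin_mns lin_zer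

lemma lin_comp: "lin f V W \<Longrightarrow> lin g W X \<Longrightarrow> lin (\<lambda>x. g (f x)) V X"
  by (simp add: lin_def)

lemma lin_mns_fun:
  assumes "lin f V W" "lin g V W" "vs W"
  shows "lin (\<lambda>x. mns W (f x) (g x)) V W"
proof (rule linI)
  fix x y c assume x: "x \<in> carr V"
  note c = lin_closed[OF assms(1)] lin_closed[OF assms(2)]
  show "mns W (f x) (g x) \<in> carr W" using c x assms by simp
  show "mns W (f (smul V c x)) (g (smul V c x)) = smul W c (mns W (f x) (g x))"
    using c x assms by (simp add: mns_def neg_def lin_smul smul_pls smul_smul mult.commute)
  assume y: "y \<in> carr V"
  show "mns W (f (pls V x y)) (g (pls V x y)) = pls W (mns W (f x) (g x)) (mns W (f y) (g y))"
    using c[OF x] c[OF y] x y assms by (simp add: mns_def neg_def lin_pls smul_pls pls_ac)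
qed

lemma subspace_image:
  assumes f: "lin f V W" and V: "vs V" "vs W" and A: "subspace V A"
  shows "subspace W (f ` A)"
  unfolding subspace_def
proof (intro conjI ballI allI)
  have Ac: "\<And>a. a \<in> A \<Longrightarrow> a \<in> carr V" using A by (rule subspace_carr)
  show "f ` A \<subseteq> carr W" using lin_closed[OF f] Ac by blast
  show "zer W \<in> f ` A" using A lin_zer[OF f V] by (metis imageI subspace_def)
  fix x assume "x \<in> f ` A"
  then obtain a where a: "x = f a" "a \<in> A" by blast
  show "smul W c x \<in> f ` A" for c
    using a A lin_smul[OF f Ac] unfolding subspace_def by (metis imageI)
  fix y assume "y \<in> f ` A"
  then obtain b where b: "y = f b" "b \<in> A" by blast
  have "f (pls V a b) = pls W x y" using a b Ac by (simp add: lin_pls[OF f])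
  then show "pls W x y \<in> f ` A" using a b A unfolding subspace_def by (metis imageI)
qed

lemma subspace_ker: "lin f V W \<Longrightarrow> vs V \<Longrightarrow> vs W \<Longrightarrow> subspace V (ker f V W)"
  by (auto simp: subspace_def ker_def lin_simps)

section \<open>Linear functionals\<close>

text \<open>The ground field as an \<open>hla\<close> record, so that a functional is a case of
  \<open>lin\<close> and every lemma on linear maps applies to it.\<close>

definition scal :: "('k::field, 'k) hla" where
  "scal = \<lparr> carr = UNIV, zer = 0, pls = (+), smul = (*), brk = (\<lambda>_ _. 0), alp = id \<rparr>"

lemma scal_simps [simp]:
  "carr scal = UNIV" "zer scal = 0" "pls scal x y = x + y" "smul scal c x = c * x"
  "neg scal x = - x" "mns scal x y = x - y"
  by (simp_all add: scal_def neg_def mns_def)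

lemma vs_scal [simp]: "vs scal"
  by (simp add: vs_def algebra_simps)

text \<open>Zorn gives a subspace \<open>A\<close> maximal among those that contain \<open>K\<close>
  and avoid \<open>x\<close>. Maximality makes \<open>A\<close> a complement of the line through
  \<open>x\<close>, and \<phi> is the \<open>x\<close>-coordinate modulo \<open>A\<close>.\<close>

lemma functional_separates:
  assumes V: "vs V" and K: "subspace V K" and x: "x \<in> carr V" "x \<notin> K"
  shows "\<exists>\<phi>. lin \<phi> V scal \<and> (\<forall>k\<in>K. \<phi> k = 0) \<and> \<phi> x \<noteq> 0"
proof -
  let ?F = "{A. subspace V A \<and> K \<subseteq> A \<and> x \<notin> A}"
  have "\<exists>A\<in>?F. \<forall>X\<in>?F. A \<subseteq> X \<longrightarrow> X = A"
  proof (rule subset_Zorn_nonempty)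
    show "?F \<noteq> {}" using K x by auto
    fix C assume C: "C \<noteq> {}" "subset.chain ?F C"
    then have sub: "\<And>A. A \<in> C \<Longrightarrow> subspace V A \<and> K \<subseteq> A \<and> x \<notin> A"
      and tot: "\<And>A B. A \<in> C \<Longrightarrow> B \<in> C \<Longrightarrow> A \<subseteq> B \<or> B \<subseteq> A"
      by (auto simp: subset.chain_def)
    have "pls V u v \<in> \<Union>C" if uv: "u \<in> \<Union>C" "v \<in> \<Union>C" for u v
    proof -
      obtain A B where "A \<in> C" "B \<in> C" "u \<in> A" "v \<in> B" using uv by blast
      moreover from this have "A \<subseteq> B \<or> B \<subseteq> A" by (simp add: tot)
      ultimately show ?thesis using sub[of A] sub[of B] unfolding subspace_def by blast
    qed
    then have "\<forall>u\<in>\<Union>C. \<forall>v\<in>\<Union>C. pls V u v \<in> \<Union>C" by (intro ballI)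
    moreover have "\<Union>C \<subseteq> carr V" "zer V \<in> \<Union>C" "\<forall>c. \<forall>u\<in>\<Union>C. smul V c u \<in> \<Union>C"
      using C(1) sub unfolding subspace_def by blast+
    ultimately have "subspace V (\<Union>C)" unfolding subspace_def by (intro conjI)
    moreover obtain A where "A \<in> C" using C(1) by blast
    then have "K \<subseteq> \<Union>C" using sub by (meson Union_upper order_trans)
    moreover have "x \<notin> \<Union>C" using sub by (meson UnionE)
    ultimately show "\<Union>C \<in> ?F" by simp
  qed
  then obtain A where AF: "A \<in> ?F" and mx: "\<forall>X\<in>?F. A \<subseteq> X \<longrightarrow> X = A" by (elim bexE)
  have A: "subspace V A" "K \<subseteq> A" "x \<notin> A" using AF by simp_all
  have max: "X = A" if "subspace V X" "x \<notin> X" "A \<subseteq> X" for X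
    using mx that A(2) by simp
  have Ac[simp]: "\<And>a. a \<in> A \<Longrightarrow> a \<in> carr V" and A0: "zer V \<in> A"
    and Ap: "\<And>a b. a \<in> A \<Longrightarrow> b \<in> A \<Longrightarrow> pls V a b \<in> A" and As: "\<And>c a. a \<in> A \<Longrightarrow> smul V c a \<in> A"
    using A(1) by (auto simp: subspace_def)
  note [simp] = V x(1)
  \<comment> \<open>For \<open>y\<close> outside \<open>A\<close>, the span of \<open>A\<close> and
    \<open>y\<close> is strictly larger, so it contains \<open>x\<close> = a + c y. Here c is not 0
    because \<open>x\<close> is not in \<open>A\<close>, and the equation can be solved for
    \<open>y\<close>.\<close>
  have ex: "\<exists>c. mns V y (smul V c x) \<in> A" if y[simp]: "y \<in> carr V" for y
  proof (cases "y \<in> A")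
    case True then show ?thesis by (intro exI[of _ 0]) (simp add: mns_def neg_def)
  next
    case False
    let ?B = "{pls V a (smul V c y) | a c. a \<in> A}"
    have "subspace V ?B" unfolding subspace_def
    proof (intro conjI ballI allI)
      show "?B \<subseteq> carr V" by auto
      show "zer V \<in> ?B" using A0 by (intro CollectI exI[of _ "zer V"] exI[of _ 0]) simp
    next
      fix u v assume "u \<in> ?B" "v \<in> ?B"
      then obtain a c b d where "u = pls V a (smul V c y)" "v = pls V b (smul V d y)" "a \<in> A" "b \<in> A"
        by blast
      then show "pls V u v \<in> ?B"
        by (intro CollectI exI[of _ "pls V a b"] exI[of _ "c + d"]) (simp add: Ap smul_add pls_ac)
    next
      fix k u assume "u \<in> ?B"
      then obtain a c where "u = pls V a (smul V c y)" "a \<in> A" by blast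
      then show "smul V k u \<in> ?B"
        by (intro CollectI exI[of _ "smul V k a"] exI[of _ "k * c"]) (simp add: As smul_pls smul_smul)
    qed
    moreover have "A \<subseteq> ?B" by (force intro: exI[of _ 0])
    moreover have "y \<in> ?B" using A0 by (intro CollectI exI[of _ "zer V"] exI[of _ 1]) simp
    ultimately have "x \<in> ?B" using max[of ?B] False by blast
    then obtain a c where xa: "x = pls V a (smul V c y)" "a \<in> A" by blast
    have c: "c \<noteq> 0" using xa A(3) by auto
    have "mns V y (smul V (1/c) x) = smul V (- (1/c)) a"
    proof -
      have [simp]: "a \<in> carr V" using xa by simp
      have "mns V y (smul V (1/c) x) = pls V (pls V y (neg V y)) (smul V (- (1/c)) a)"
        unfolding xa(1) mns_def neg_def using c by (simp add: smul_pls smul_smul pls_ac)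
      then show ?thesis by simp
    qed
    then show ?thesis using As xa by metis
  qed
  \<comment> \<open>Two different coordinates would put a nonzero multiple of \<open>x\<close> into
    \<open>A\<close>.\<close>
  have un: "c = d" if cd: "mns V y (smul V c x) \<in> A" "mns V y (smul V d x) \<in> A" and [simp]: "y \<in> carr V" for y c d
  proof (rule ccontr)
    assume ne: "c \<noteq> d"
    have "mns V (mns V y (smul V c x)) (mns V y (smul V d x))
        = pls V (pls V y (neg V y)) (pls V (smul V d x) (smul V (-c) x))"
      unfolding mns_def neg_def by (simp add: smul_pls smul_smul pls_ac)
    also have "\<dots> = smul V (d - c) x" using smul_add[of V x d "-c"] by simp
    finally have "smul V (d - c) x \<in> A" using subspace_mns[OF A(1) cd] by simp
    then have "smul V (1 / (d - c)) (smul V (d - c) x) \<in> A" by (rule As)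
    then show False using ne A(3) by (simp add: smul_smul)
  qed
  define \<phi> where "\<phi> y = (THE c. mns V y (smul V c x) \<in> A)" for y
  have \<phi>: "\<phi> y = c" if "mns V y (smul V c x) \<in> A" "y \<in> carr V" for y c
    unfolding \<phi>_def using that un by blast
  have \<phi>A: "mns V y (smul V (\<phi> y) x) \<in> A" if "y \<in> carr V" for y
    using ex[OF that] \<phi> that by blast
  have "lin \<phi> V scal"
  proof (rule linI)
    fix y z assume [simp]: "y \<in> carr V" "z \<in> carr V"
    have "mns V (pls V y z) (smul V (\<phi> y + \<phi> z) x)
       = pls V (mns V y (smul V (\<phi> y) x)) (mns V z (smul V (\<phi> z) x))"
      unfolding mns_def neg_def by (simp add: smul_pls smul_smul smul_add pls_ac)
    then have "\<phi> (pls V y z) = \<phi> y + \<phi> z" by (intro \<phi>) (simp_all add: \<phi>A Ap)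
    then show "\<phi> (pls V y z) = pls scal (\<phi> y) (\<phi> z)" by simp
  next
    fix c y assume [simp]: "y \<in> carr V"
    have "mns V (smul V c y) (smul V (c * \<phi> y) x) = smul V c (mns V y (smul V (\<phi> y) x))"
      unfolding mns_def neg_def by (simp add: smul_pls smul_smul)
    then have "\<phi> (smul V c y) = c * \<phi> y" by (intro \<phi>) (simp_all add: \<phi>A As)
    then show "\<phi> (smul V c y) = smul scal c (\<phi> y)" by simp
  qed simp
  moreover have "\<forall>k\<in>K. \<phi> k = 0" using A(2) by (auto intro!: \<phi> simp: mns_def neg_def)
  moreover have "\<phi> x = 1" using A0 by (intro \<phi>) (simp_all add: mns_def)
  ultimately show ?thesis by (metis zero_neq_one)
qed

text \<open>The case of the zero subspace. It moves an identity between \<open>pls\<close>,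
  \<open>mns\<close> and \<open>neg\<close> terms into the field, where ordinary ring simplification
  settles it.\<close>

lemma vs_eqI:
  assumes V: "vs V" and xy: "x \<in> carr V" "y \<in> carr V"
    and eq: "\<And>\<phi>. lin \<phi> V scal \<Longrightarrow> \<phi> x = \<phi> y"
  shows "x = y"
proof (rule ccontr)
  assume "x \<noteq> y"
  then have "mns V x y \<notin> {zer V}" using mns_eq_zer[OF V xy] by auto
  moreover have "subspace V {zer V}" using V by (simp add: subspace_def)
  ultimately obtain \<phi> where \<phi>: "lin \<phi> V scal" "\<phi> (mns V x y) \<noteq> 0"
    using functional_separates[of V "{zer V}" "mns V x y"] V xy by auto
  then show False using eq[OF \<phi>(1)] V xy by (simp add: lin_mns[OF \<phi>(1)])
qed

text \<open>This replaces the quotient by \<open>K\<close>: functionals on it are the functionals on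
  \<open>V\<close> that vanish on \<open>K\<close>.\<close>

lemma subspace_memI:
  assumes "vs V" "subspace V K" "x \<in> carr V"
    and "\<And>\<phi>. lin \<phi> V scal \<Longrightarrow> (\<And>k. k \<in> K \<Longrightarrow> \<phi> k = 0) \<Longrightarrow> \<phi> x = 0"
  shows "x \<in> K"
  using functional_separates[OF assms(1-3)] assms(4) by blast

lemma functional_simps:
  assumes "lin \<phi> V scal" "vs V"
  shows "\<phi> (zer V) = 0"
    and "x \<in> carr V \<Longrightarrow> y \<in> carr V \<Longrightarrow> \<phi> (pls V x y) = \<phi> x + \<phi> y"
    and "x \<in> carr V \<Longrightarrow> \<phi> (smul V c x) = c * \<phi> x"
    and "x \<in> carr V \<Longrightarrow> \<phi> (neg V x) = - \<phi> x"
    and "x \<in> carr V \<Longrightarrow> y \<in> carr V \<Longrightarrow> \<phi> (mns V x y) = \<phi> x - \<phi> y"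
  using lin_simps[OF assms(1)] assms(2) by (simp_all add: lin_zer[OF assms(1)])

text \<open>The two cancellations behind the Hom-action axioms for a bracket with \<alpha>(m) on the
  left.\<close>

lemma
  assumes "vs V" "x \<in> carr V" "y \<in> carr V"
  shows mns_mns_left: "mns V (mns V x y) x = neg V y" and mns_mns_right: "mns V x (mns V x y) = y"
proof -
  show "mns V (mns V x y) x = neg V y"
  proof (rule vs_eqI[OF assms(1)])
    fix \<phi> assume \<phi>: "lin \<phi> V scal"
    show "\<phi> (mns V (mns V x y) x) = \<phi> (neg V y)" using assms by (simp add: functional_simps[OF \<phi>])
  qed (use assms in simp_all)
  show "mns V x (mns V x y) = y"
  proof (rule vs_eqI[OF assms(1)])
    fix \<phi> assume \<phi>: "lin \<phi> V scal"
    show "\<phi> (mns V x (mns V x y)) = \<phi> y" using assms by (simp add: functional_simps[OF \<phi>])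
  qed (use assms in simp_all)
qed

text \<open>\<open>vsum\<close> runs along an enumeration picked by choice. Its image under a
  functional is a finite sum in the field, where the order no longer matters.\<close>

lemma vsum_functional:
  assumes W: "vs W" and A: "finite A" "\<And>a. a \<in> A \<Longrightarrow> g a \<in> carr W"
  shows "vsum W g A \<in> carr W" "lin \<phi> W scal \<Longrightarrow> \<phi> (vsum W g A) = (\<Sum>a\<in>A. \<phi> (g a))"
proof -
  define xs where "xs = (SOME xs. distinct xs \<and> set xs = A)"
  have xs: "distinct xs" "set xs = A"
    using someI_ex[OF finite_distinct_list[OF A(1)], unfolded conj_commute[of "set _ = _"]] by (auto simp: xs_def)
  have cl: "vsuml W (map g ys) \<in> carr W" if "set ys \<subseteq> A" for ys
    using that by (induction ys) (auto simp: W A(2))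
  show "vsum W g A \<in> carr W" using cl[of xs] xs by (simp add: vsum_def xs_def)
  assume \<phi>: "lin \<phi> W scal"
  have "\<phi> (vsuml W (map g ys)) = (\<Sum>a\<leftarrow>ys. \<phi> (g a))" if "set ys \<subseteq> A" for ys
    using that by (induction ys) (auto simp: W A(2) cl functional_simps[OF \<phi> W])
  then show "\<phi> (vsum W g A) = (\<Sum>a\<in>A. \<phi> (g a))"
    using xs by (simp add: vsum_def sum_list_distinct_conv_sum_set flip: xs_def)
qed

section \<open>The universal central extension\<close>

lemma supp_delta [simp]: "supp (delta p :: _ \<Rightarrow> 'k::field) = {p}"
  by (auto simp: supp_def delta_def)

lemma supp_fadd: "supp (fadd f g) \<subseteq> supp f \<union> supp g"
  by (auto simp: supp_def fadd_def)

lemma supp_fsmul: "supp (fsmul c f) \<subseteq> supp f"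
  by (auto simp: supp_def fsmul_def)

lemma fsub_eq: "fsub f g = fadd f (fsmul (-1) g)"
  by (auto simp: fsub_def fadd_def fsmul_def)

lemma supp_push: "supp (push h f) \<subseteq> h ` supp f"
proof
  fix z assume z: "z \<in> supp (push h f)"
  have "{p \<in> supp f. h p = z} \<noteq> {}"
  proof
    assume "{p \<in> supp f. h p = z} = {}"
    then have "push h f z = 0" unfolding push_def by (simp only: sum.empty)
    then show False using z by (simp add: supp_def)
  qed
  then show "z \<in> h ` supp f" by blast
qed

text \<open>The linear extension of a form from basis pairs to free vectors. Scalar values suffice,
  since vector-valued forms are composed with functionals first.\<close>

definition ext :: "('a \<Rightarrow> 'a \<Rightarrow> 'k::field) \<Rightarrow> ('a \<times> 'a \<Rightarrow> 'k) \<Rightarrow> 'k" where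
  "ext c f = (\<Sum>p\<in>supp f. f p * c (fst p) (snd p))"

text \<open>Supports shrink under cancellation, so sums are moved to a common finite index set
  before they are compared; the extra terms vanish.\<close>

lemma ext_superset: "finite A \<Longrightarrow> supp f \<subseteq> A \<Longrightarrow> ext c f = (\<Sum>p\<in>A. f p * c (fst p) (snd p))"
  unfolding ext_def by (rule sum.mono_neutral_left) (auto simp: supp_def)

lemma ext_fadd:
  assumes "finite (supp f)" "finite (supp g)"
  shows "ext c (fadd f g) = ext c f + ext c g"
proof -
  let ?A = "supp f \<union> supp g"
  have "finite ?A" using assms by simp
  then show ?thesis
    using supp_fadd[of f g]
    by (simp add: ext_superset[of ?A] fadd_def distrib_right flip: sum.distrib)
qed

lemma ext_fsmul: "finite (supp f) \<Longrightarrow> ext c (fsmul k f) = k * ext c f"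
  using supp_fsmul[of k f]
  by (simp add: ext_superset[of "supp f"] fsmul_def sum_distrib_left mult.assoc)

lemma ext_delta [simp]: "ext c (delta (a, b)) = c a b"
  unfolding ext_def supp_delta by (simp add: delta_def)

lemma ext_zero [simp]: "ext c (\<lambda>_. 0) = 0"
  by (simp add: ext_def)

text \<open>The sum over the support is regrouped by the fibres of
  \<open>map_prod g g\<close>.\<close>

lemma ext_push:
  assumes f: "finite (supp f)"
  shows "ext c (push (map_prod g g) f) = ext (\<lambda>a b. c (g a) (g b)) f"
proof -
  let ?h = "map_prod g g"
  have "ext c (push ?h f) = (\<Sum>z\<in>?h ` supp f. push ?h f z * c (fst z) (snd z))"
    using f supp_push[of ?h f] by (intro ext_superset) auto
  also have "\<dots> = (\<Sum>z\<in>?h ` supp f. \<Sum>p\<in>{p \<in> supp f. ?h p = z}. f p * c (g (fst p)) (g (snd p)))"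
    unfolding push_def sum_distrib_right by (intro sum.cong) auto
  also have "\<dots> = ext (\<lambda>a b. c (g a) (g b)) f"
    unfolding ext_def using f by (rule sum.image_gen[symmetric])
  finally show ?thesis .
qed

lemma supp_fbr:
  "supp (fbr L f g) \<subseteq> (\<lambda>(p, q). (brk L (fst p) (snd p), brk L (fst q) (snd q))) ` (supp f \<times> supp g)"
proof
  fix z assume "z \<in> supp (fbr L f g)"
  then have "fbr L f g z \<noteq> 0" by (simp add: supp_def)
  then obtain p q where "p \<in> supp f" "q \<in> supp g" "(brk L (fst p) (snd p), brk L (fst q) (snd q)) = z"
    unfolding fbr_def by (smt (verit, best) sum.neutral)
  then show "z \<in> (\<lambda>(p, q). (brk L (fst p) (snd p), brk L (fst q) (snd q))) ` (supp f \<times> supp g)"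
    by force
qed

text \<open>Once the sum over \<open>z\<close> is innermost, the indicator in \<open>fbr\<close>
  selects the one pair of brackets that belongs to \<open>p\<close> and \<open>q\<close>.\<close>

lemma ext_fbr:
  assumes f: "finite (supp f)" "finite (supp g)"
  shows "ext c (fbr L f g) =
    ext (\<lambda>a b. ext (\<lambda>a' b'. c (brk L a b) (brk L a' b')) g) f"
proof -
  let ?B = "\<lambda>p. brk L (fst p) (snd p)"
  let ?A = "(\<lambda>(p, q). (?B p, ?B q)) ` (supp f \<times> supp g)"
  have A: "finite ?A" using f by simp
  have "ext c (fbr L f g) = (\<Sum>z\<in>?A. fbr L f g z * c (fst z) (snd z))"
    using A supp_fbr by (rule ext_superset)
  also have "\<dots> = (\<Sum>z\<in>?A. \<Sum>p\<in>supp f. \<Sum>q\<in>supp g.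
      if (?B p, ?B q) = z then f p * g q * c (?B p) (?B q) else 0)"
    unfolding fbr_def sum_distrib_right by (intro sum.cong) auto
  also have "\<dots> = (\<Sum>p\<in>supp f. \<Sum>z\<in>?A. \<Sum>q\<in>supp g.
      if (?B p, ?B q) = z then f p * g q * c (?B p) (?B q) else 0)"
    by (rule sum.swap)
  also have "\<dots> = (\<Sum>p\<in>supp f. \<Sum>q\<in>supp g. \<Sum>z\<in>?A.
      if (?B p, ?B q) = z then f p * g q * c (?B p) (?B q) else 0)"
    by (intro sum.cong refl sum.swap)
  also have "\<dots> = (\<Sum>p\<in>supp f. \<Sum>q\<in>supp g. f p * g q * c (?B p) (?B q))"
    using A by (intro sum.cong refl) (auto simp: sum.delta')
  finally show ?thesis by (simp add: ext_def sum_distrib_left mult.assoc)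
qed

text \<open>The formula of \<open>Uce\<close> with an arbitrary \<open>b\<close> in place of the
  bracket. It evaluates at the chosen representative; for a \<open>leibniz_map\<close> the choice
  turns out not to matter.\<close>

definition lift :: "('k::field, 'w) hla \<Rightarrow> ('a \<Rightarrow> 'a \<Rightarrow> 'w) \<Rightarrow> ('a \<times> 'a \<Rightarrow> 'k) set \<Rightarrow> 'w" where
  "lift W b X = vsum W (\<lambda>p. smul W (rep X p) (b (fst p) (snd p))) (supp (rep X))"

section \<open>The quotient space and its universal property\<close>

locale perfect_hom_leibniz =
  fixes L :: "('k::field, 'a) hla"
  assumes hom_leibniz: "hom_leibniz L" and perfect: "alpha_perfect L"
begin

lemma vs_L [simp]: "vs L"
  using hom_leibniz by (simp add: hom_leibniz_def)

lemma lin_brk: "x \<in> carr L \<Longrightarrow> lin (brk L x) L L" "y \<in> carr L \<Longrightarrow> lin (\<lambda>x. brk L x y) L L"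
  using hom_leibniz unfolding hom_leibniz_def by meson+

lemma lin_alp: "lin (alp L) L L"
  using hom_leibniz unfolding hom_leibniz_def by meson

lemma brk_closed [simp]: "x \<in> carr L \<Longrightarrow> y \<in> carr L \<Longrightarrow> brk L x y \<in> carr L"
  by (rule lin_closed[OF lin_brk(1)])

lemma alp_closed [simp]: "x \<in> carr L \<Longrightarrow> alp L x \<in> carr L"
  by (rule lin_closed[OF lin_alp])

lemma leibniz: "x \<in> carr L \<Longrightarrow> y \<in> carr L \<Longrightarrow> z \<in> carr L \<Longrightarrow>
    brk L (alp L x) (brk L y z) = mns L (brk L (brk L x y) (alp L z)) (brk L (brk L x z) (alp L y))"
  using hom_leibniz unfolding hom_leibniz_def by meson

lemma alp_brk: "x \<in> carr L \<Longrightarrow> y \<in> carr L \<Longrightarrow> alp L (brk L x y) = brk L (alp L x) (alp L y)"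
  using hom_leibniz unfolding hom_leibniz_def by meson

text \<open>The image of \<alpha> is a subspace, and it contains the spanning elements
  [\<alpha> x, \<alpha> y] = \<alpha> [x, y]. From here on the free space lives on all pairs from
  \<open>carr L\<close>.\<close>

lemma alp_surj: "alp L ` carr L = carr L"
proof
  show "alp L ` carr L \<subseteq> carr L" by auto
  have "subspace L (alp L ` carr L)"
    by (intro subspace_image[OF lin_alp] subspace_carrier) simp_all
  moreover have "{brk L (alp L x) (alp L y) |x y. x \<in> carr L \<and> y \<in> carr L} \<subseteq> alp L ` carr L"
    by (auto simp flip: alp_brk)
  ultimately have "span_in L {brk L (alp L x) (alp L y) |x y. x \<in> carr L \<and> y \<in> carr L} \<subseteq> alp L ` carr L"
    by (rule span_in_subset)
  then show "carr L \<subseteq> alp L ` carr L"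
    by (rule ord_eq_le_trans[OF perfect[unfolded alpha_perfect_def]])
qed

lemma carr_span_brk: "carr L = span_in L {brk L x y | x y. x \<in> carr L \<and> y \<in> carr L}"
proof -
  have "{brk L (alp L x) (alp L y) |x y. x \<in> carr L \<and> y \<in> carr L}
      = {brk L x y | x y. x \<in> alp L ` carr L \<and> y \<in> alp L ` carr L}" by blast
  also have "\<dots> = {brk L x y | x y. x \<in> carr L \<and> y \<in> carr L}" unfolding alp_surj ..
  finally show ?thesis by (rule subst) (rule perfect[unfolded alpha_perfect_def])
qed

lemma FL_eq: "FL L = {f. finite (supp f) \<and> supp f \<subseteq> carr L \<times> carr L}"
  by (simp add: FL_def alp_surj)

lemma FL_closed [simp]:
  "(\<lambda>_. 0) \<in> FL L"
  "f \<in> FL L \<Longrightarrow> g \<in> FL L \<Longrightarrow> fadd f g \<in> FL L"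
  "f \<in> FL L \<Longrightarrow> fsmul c f \<in> FL L"
  "f \<in> FL L \<Longrightarrow> g \<in> FL L \<Longrightarrow> fsub f g \<in> FL L"
  "a \<in> carr L \<Longrightarrow> b \<in> carr L \<Longrightarrow> delta (a, b) \<in> FL L"
proof -
  show add: "f \<in> FL L \<Longrightarrow> g \<in> FL L \<Longrightarrow> fadd f g \<in> FL L" for f g
    using supp_fadd[of f g] by (auto simp: FL_eq intro: finite_subset[of _ "supp f \<union> supp g"])
  show smul: "f \<in> FL L \<Longrightarrow> fsmul c f \<in> FL L" for f c
    using supp_fsmul[of c f] by (auto simp: FL_eq intro: finite_subset[of _ "supp f"])
  show "f \<in> FL L \<Longrightarrow> g \<in> FL L \<Longrightarrow> fsub f g \<in> FL L"
    by (simp add: fsub_eq add smul)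
qed (auto simp: FL_eq, auto simp: supp_def)

lemma FL_finite: "f \<in> FL L \<Longrightarrow> finite (supp f)"
  by (simp add: FL_eq)

text \<open>The induction is over a finite set that bounds the support. Splitting off one point of
  this set then works whether or not \<open>f\<close> vanishes there.\<close>

lemma FL_induct [consumes 1, case_names zero delta add smul]:
  assumes f: "f \<in> FL L"
    and zero: "P (\<lambda>_. 0)"
    and delta: "\<And>a b. a \<in> carr L \<Longrightarrow> b \<in> carr L \<Longrightarrow> P (delta (a, b))"
    and add: "\<And>f g. f \<in> FL L \<Longrightarrow> g \<in> FL L \<Longrightarrow> P f \<Longrightarrow> P g \<Longrightarrow> P (fadd f g)"
    and smul: "\<And>c f. f \<in> FL L \<Longrightarrow> P f \<Longrightarrow> P (fsmul c f)"
  shows "P f"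
proof -
  have "\<forall>f. supp f \<subseteq> A \<longrightarrow> A \<subseteq> carr L \<times> carr L \<longrightarrow> P f" if "finite A" for A
    using that
  proof (induction A)
    case empty
    have "f = (\<lambda>_. 0)" if "supp f \<subseteq> {}" for f :: "'a \<times> 'a \<Rightarrow> 'k"
      using that by (auto simp: supp_def)
    then show ?case using zero by metis
  next
    case (insert p A)
    show ?case
    proof (intro allI impI)
      fix f :: "'a \<times> 'a \<Rightarrow> 'k"
      assume s: "supp f \<subseteq> insert p A" and A: "insert p A \<subseteq> carr L \<times> carr L"
      let ?g = "f(p := 0)"
      obtain a b where p: "p = (a, b)" "a \<in> carr L" "b \<in> carr L" using A by auto
      have g: "supp ?g \<subseteq> A" using s by (auto simp: supp_def)
      have A': "A \<subseteq> carr L \<times> carr L" using A by simp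
      have "P ?g" using insert.IH g A' by blast
      moreover have "?g \<in> FL L"
        unfolding FL_eq using finite_subset[OF g insert.hyps(1)] subset_trans[OF g A'] by (intro CollectI conjI)
      ultimately have "P (fadd (fsmul (f p) (delta (a, b))) ?g)"
        by (intro add[OF FL_closed(3)] smul delta FL_closed(5) p(2,3))
      moreover have "fadd (fsmul (f p) (delta (a, b))) ?g = f"
        by (auto simp: fadd_def fsmul_def delta_def p(1))
      ultimately show "P f" by simp
    qed
  qed
  then show ?thesis using f by (auto simp: FL_eq)
qed

lemma Rbil_eq: "Rbil L =
     {fsub (fsub (delta (pls L a a', b)) (delta (a, b))) (delta (a', b)) | a a' b. a \<in> carr L \<and> a' \<in> carr L \<and> b \<in> carr L}
   \<union> {fsub (fsub (delta (a, pls L b b')) (delta (a, b))) (delta (a, b')) | a b b'. a \<in> carr L \<and> b \<in> carr L \<and> b' \<in> carr L}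
   \<union> {fsub (delta (smul L c a, b)) (fsmul c (delta (a, b))) | c a b. a \<in> carr L \<and> b \<in> carr L}
   \<union> {fsub (delta (a, smul L c b)) (fsmul c (delta (a, b))) | c a b. a \<in> carr L \<and> b \<in> carr L}"
  unfolding Rbil_def Let_def alp_surj ..

lemma NL_zero: "(\<lambda>_. 0) \<in> NL L"
  and NL_fadd: "f \<in> NL L \<Longrightarrow> g \<in> NL L \<Longrightarrow> fadd f g \<in> NL L"
  and NL_fsmul: "f \<in> NL L \<Longrightarrow> fsmul c f \<in> NL L"
  using span_zero[of "freeV L" "Rbil L \<union> IL L"] span_add[of f "freeV L" "Rbil L \<union> IL L" g]
    span_smul[of f "freeV L" "Rbil L \<union> IL L" c]
  by (simp_all add: NL_def freeV_def)

lemma NL_fsub: "f \<in> NL L \<Longrightarrow> g \<in> NL L \<Longrightarrow> fsub f g \<in> NL L"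
  by (simp add: fsub_eq NL_fadd NL_fsmul)

lemma NL_base: "f \<in> Rbil L \<union> IL L \<Longrightarrow> f \<in> NL L"
  unfolding NL_def by (rule span_base)

lemma NL_induct [consumes 1, case_names zero Rbil IL add smul]:
  assumes f: "f \<in> NL L"
    and zero: "P (\<lambda>_. 0)"
    and Rbil: "\<And>f. f \<in> Rbil L \<Longrightarrow> P f" and IL: "\<And>f. f \<in> IL L \<Longrightarrow> P f"
    and add: "\<And>f g. f \<in> NL L \<Longrightarrow> g \<in> NL L \<Longrightarrow> P f \<Longrightarrow> P g \<Longrightarrow> P (fadd f g)"
    and smul: "\<And>c f. f \<in> NL L \<Longrightarrow> P f \<Longrightarrow> P (fsmul c f)"
  shows "P f"
  using f unfolding NL_def
proof (induction rule: span_in.induct)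
  case (span_add x y) then show ?case using add by (simp add: NL_def freeV_def)
next
  case (span_smul x c) then show ?case using smul by (simp add: NL_def freeV_def)
qed (use zero Rbil IL in \<open>auto simp: freeV_def\<close>)

lemma NL_FL: "f \<in> NL L \<Longrightarrow> f \<in> FL L"
  by (induction rule: NL_induct) (auto simp: Rbil_eq IL_def)

lemma cls_eq_iff:
  assumes "f \<in> FL L" "g \<in> FL L"
  shows "cls L f = cls L g \<longleftrightarrow> fsub f g \<in> NL L"
proof
  assume "cls L f = cls L g"
  moreover have "f \<in> cls L f" using assms NL_zero by (simp add: cls_def fsub_def)
  ultimately show "fsub f g \<in> NL L" by (simp add: cls_def)
next
  assume fg: "fsub f g \<in> NL L"
  have "fsub h f \<in> NL L \<longleftrightarrow> fsub h g \<in> NL L" for h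
  proof -
    have "fsub h g = fadd (fsub h f) (fsub f g)" "fsub h f = fsub (fsub h g) (fsub f g)"
      by (auto simp: fsub_def fadd_def)
    then show ?thesis using fg NL_fadd NL_fsub by metis
  qed
  then show "cls L f = cls L g" by (auto simp: cls_def)
qed

lemma rep_cls: assumes "f \<in> FL L" shows "rep (cls L f) \<in> FL L" "fsub (rep (cls L f)) f \<in> NL L"
proof -
  have "f \<in> cls L f" using assms NL_zero by (simp add: cls_def fsub_def)
  then have "rep (cls L f) \<in> cls L f" unfolding rep_def by (rule someI[where P = "\<lambda>h. h \<in> cls L f"])
  then show "rep (cls L f) \<in> FL L" "fsub (rep (cls L f)) f \<in> NL L" by (auto simp: cls_def)
qed

lemma cls_rep [simp]: "f \<in> FL L \<Longrightarrow> cls L (rep (cls L f)) = cls L f"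
  by (simp add: cls_eq_iff rep_cls)

text \<open>The record operations use \<open>rep\<close>; any other member of the class may replace
  it, because the errors are sums and multiples of elements of \<open>NL L\<close>.\<close>

lemma uce_simps:
  "carr (uce L) = cls L ` FL L"
  "zer (uce L) = cls L (\<lambda>_. 0)"
  "f \<in> FL L \<Longrightarrow> g \<in> FL L \<Longrightarrow> pls (uce L) (cls L f) (cls L g) = cls L (fadd f g)"
  "f \<in> FL L \<Longrightarrow> smul (uce L) c (cls L f) = cls L (fsmul c f)"
proof -
  assume f: "f \<in> FL L"
  note r = rep_cls[OF f]
  have "fsub (fsmul c (rep (cls L f))) (fsmul c f) = fsmul c (fsub (rep (cls L f)) f)"
    by (auto simp: fsub_def fsmul_def algebra_simps)
  then show "smul (uce L) c (cls L f) = cls L (fsmul c f)"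
    using r f by (simp add: uce_def cls_eq_iff NL_fsmul)
  assume g: "g \<in> FL L"
  note r' = rep_cls[OF g]
  have "fsub (fadd (rep (cls L f)) (rep (cls L g))) (fadd f g)
      = fadd (fsub (rep (cls L f)) f) (fsub (rep (cls L g)) g)"
    by (auto simp: fsub_def fadd_def algebra_simps)
  then show "pls (uce L) (cls L f) (cls L g) = cls L (fadd f g)"
    using r f r' g by (simp add: uce_def cls_eq_iff NL_fadd)
qed (simp_all add: uce_def)

lemma cls_closed [simp]: "f \<in> FL L \<Longrightarrow> cls L f \<in> carr (uce L)"
  by (simp add: uce_simps)

lemma vs_uce [simp]: "vs (uce L)"
proof -
  have n: "neg (uce L) (cls L f) = cls L (fsmul (-1) f)" if "f \<in> FL L" for f
    using that by (simp add: neg_def uce_simps)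
  show ?thesis
    unfolding vs_def uce_simps(1)
    apply (simp add: uce_simps n)
    apply (auto intro!: arg_cong[of _ _ "cls L"] simp: fadd_def fsmul_def algebra_simps)
    done
qed

lemma gen_closed [simp]: "a \<in> carr L \<Longrightarrow> b \<in> carr L \<Longrightarrow> gen L a b \<in> carr (uce L)"
  by (simp add: gen_def uce_simps)

definition leibniz_map :: "('k, 'w) hla \<Rightarrow> ('a \<Rightarrow> 'a \<Rightarrow> 'w) \<Rightarrow> bool" where
  "leibniz_map W b \<longleftrightarrow>
     (\<forall>x\<in>carr L. lin (b x) L W \<and> lin (\<lambda>y. b y x) L W) \<and>
     (\<forall>x\<in>carr L. \<forall>y\<in>carr L. \<forall>z\<in>carr L.
        b (alp L x) (brk L y z) = mns W (b (brk L x y) (alp L z)) (b (brk L x z) (alp L y)))"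

lemma leibniz_map_comp:
  assumes b: "leibniz_map W b" and f: "lin f W X" and W: "vs W"
  shows "leibniz_map X (\<lambda>x y. f (b x y))"
proof -
  have "b x y \<in> carr W" if "x \<in> carr L" "y \<in> carr L" for x y
    using b that lin_closed unfolding leibniz_map_def by metis
  then have "\<And>x y z w. x \<in> carr L \<Longrightarrow> y \<in> carr L \<Longrightarrow> z \<in> carr L \<Longrightarrow> w \<in> carr L \<Longrightarrow>
     f (mns W (b x y) (b z w)) = mns X (f (b x y)) (f (b z w))"
    using lin_mns[OF f W] by simp
  then show ?thesis using b unfolding leibniz_map_def by (auto intro: lin_comp[OF _ f])
qed

lemma leibniz_map_NL:
  assumes c: "leibniz_map scal c" and f: "f \<in> NL L"
  shows "ext c f = 0"
  using f
proof (induction rule: NL_induct)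
  case (Rbil f)
  have "c (pls L x y) z = c x z + c y z" "c z (pls L x y) = c z x + c z y"
    "c (smul L k x) z = k * c x z" "c z (smul L k x) = k * c z x"
    if xyz: "x \<in> carr L" "y \<in> carr L" "z \<in> carr L" for x y z k
  proof -
    have "lin (c z) L scal" "lin (\<lambda>x. c x z) L scal" using c xyz(3) by (auto simp: leibniz_map_def)
    note l = functional_simps[OF this(1) vs_L] functional_simps[OF this(2) vs_L]
    show "c (pls L x y) z = c x z + c y z" "c z (pls L x y) = c z x + c z y"
      "c (smul L k x) z = k * c x z" "c z (smul L k x) = k * c z x"
      using l xyz by simp_all
  qed
  then show ?case using Rbil
    by (auto simp: Rbil_eq fsub_eq ext_fadd ext_fsmul finite_subset[OF supp_fadd] finite_subset[OF supp_fsmul])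
next
  case (IL f)
  have "c (alp L x) (brk L y z) = c (brk L x y) (alp L z) - c (brk L x z) (alp L y)"
    if "x \<in> carr L" "y \<in> carr L" "z \<in> carr L" for x y z
    using c that unfolding leibniz_map_def by simp
  then show ?case using IL
    by (auto simp: IL_def ext_fadd ext_fsmul finite_subset[OF supp_fadd] finite_subset[OF supp_fsmul])
qed (simp_all add: ext_fadd ext_fsmul FL_finite NL_FL)

lemma ext_rep:
  assumes c: "leibniz_map scal c" and f: "f \<in> FL L"
  shows "ext c (rep (cls L f)) = ext c f"
  using leibniz_map_NL[OF c rep_cls(2)[OF f]] rep_cls(1)[OF f] f
  by (simp add: fsub_eq ext_fadd ext_fsmul FL_finite finite_subset[OF supp_fsmul])

text \<open>Composing \<open>b\<close> with \<phi> gives a scalar form that kills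
  \<open>NL L\<close>, so by \<open>ext_rep\<close> the chosen representative can be exchanged for
  \<open>f\<close>.\<close>

lemma functional_lift:
  assumes b: "leibniz_map W b" and W: "vs W" and f: "f \<in> FL L"
  shows "lift W b (cls L f) \<in> carr W"
    and "lin \<phi> W scal \<Longrightarrow> \<phi> (lift W b (cls L f)) = ext (\<lambda>x y. \<phi> (b x y)) f"
proof -
  have r: "finite (supp (rep (cls L f)))" "supp (rep (cls L f)) \<subseteq> carr L \<times> carr L"
    using rep_cls(1)[OF f] by (auto simp: FL_eq)
  have bW: "b x y \<in> carr W" if "x \<in> carr L" "y \<in> carr L" for x y
    using b that lin_closed unfolding leibniz_map_def by metis
  have p: "smul W (rep (cls L f) p) (b (fst p) (snd p)) \<in> carr W" if "p \<in> supp (rep (cls L f))" for p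
    using that r(2) by (intro vs_smul bW W) auto
  show "lift W b (cls L f) \<in> carr W" unfolding lift_def by (rule vsum_functional[OF W r(1) p])
  assume \<phi>: "lin \<phi> W scal"
  have "\<phi> (lift W b (cls L f))
      = (\<Sum>p\<in>supp (rep (cls L f)). \<phi> (smul W (rep (cls L f) p) (b (fst p) (snd p))))"
    unfolding lift_def by (rule vsum_functional(2)[OF W r(1) p \<phi>])
  also have "\<dots> = ext (\<lambda>x y. \<phi> (b x y)) (rep (cls L f))"
    unfolding ext_def using r(2) by (intro sum.cong refl functional_simps(3)[OF \<phi> W] bW) auto
  finally show "\<phi> (lift W b (cls L f)) = ext (\<lambda>x y. \<phi> (b x y)) f"
    using ext_rep[OF leibniz_map_comp[OF b \<phi> W] f] by simp
qed

lemma lin_lift: assumes b: "leibniz_map W b" and W: "vs W" shows "lin (lift W b) (uce L) W"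
proof (rule linI)
  fix X Y c assume "X \<in> carr (uce L)"
  then obtain f where f: "X = cls L f" "f \<in> FL L" by (auto simp: uce_simps)
  note lf = functional_lift[OF b W]
  show "lift W b X \<in> carr W" using lf f by simp
  show "lift W b (smul (uce L) c X) = smul W c (lift W b X)"
  proof (rule vs_eqI[OF W])
    fix \<phi> assume \<phi>: "lin \<phi> W scal"
    show "\<phi> (lift W b (smul (uce L) c X)) = \<phi> (smul W c (lift W b X))"
      using f \<phi> by (simp add: uce_simps lf functional_simps[OF \<phi> W] ext_fsmul FL_finite)
  qed (use f lf W in \<open>simp_all add: uce_simps\<close>)
  assume "Y \<in> carr (uce L)"
  then obtain g where g: "Y = cls L g" "g \<in> FL L" by (auto simp: uce_simps)
  show "lift W b (pls (uce L) X Y) = pls W (lift W b X) (lift W b Y)"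
  proof (rule vs_eqI[OF W])
    fix \<phi> assume \<phi>: "lin \<phi> W scal"
    show "\<phi> (lift W b (pls (uce L) X Y)) = \<phi> (pls W (lift W b X) (lift W b Y))"
      using f g \<phi> by (simp add: uce_simps lf functional_simps[OF \<phi> W] ext_fadd FL_finite)
  qed (use f g lf W in \<open>simp_all add: uce_simps\<close>)
qed

lemma lift_gen:
  assumes b: "leibniz_map W b" and W: "vs W" and xy: "x \<in> carr L" "y \<in> carr L"
  shows "lift W b (gen L x y) = b x y"
proof (rule vs_eqI[OF W])
  show "b x y \<in> carr W" using b xy lin_closed unfolding leibniz_map_def by metis
  note F = FL_closed(5)[OF xy]
  show "lift W b (gen L x y) \<in> carr W" unfolding gen_def by (rule functional_lift(1)[OF b W F])
  show "\<phi> (lift W b (gen L x y)) = \<phi> (b x y)" if "lin \<phi> W scal" for \<phi>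
    unfolding gen_def functional_lift(2)[OF b W F that] by simp
qed

text \<open>For each identity, the difference of the two free vectors is, up to reordering, one of
  the generators of \<open>NL L\<close>.\<close>

lemma gen_leibniz_map: "leibniz_map (uce L) (gen L)"
proof -
  have cI: "cls L f = cls L g" if "f \<in> FL L" "g \<in> FL L" "h \<in> Rbil L \<union> IL L" "fsub f g = h" for f g h
    using that by (simp add: cls_eq_iff NL_base)
  have "lin (gen L a) L (uce L)" if a: "a \<in> carr L" for a
  proof (rule linI)
    fix x y c assume x: "x \<in> carr L"
    show "gen L a (smul L c x) = smul (uce L) c (gen L a x)"
      using a x unfolding gen_def uce_simps(4)[OF FL_closed(5)[OF a x]]
      by (intro cI[OF _ _ _ refl]) (simp_all, unfold Rbil_eq, blast)
    assume y: "y \<in> carr L"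
    have "fsub (delta (a, pls L x y)) (fadd (delta (a, x)) (delta (a, y)))
      = fsub (fsub (delta (a, pls L x y)) (delta (a, x))) (delta (a, y))"
      by (auto simp: fsub_def fadd_def algebra_simps)
    then show "gen L a (pls L x y) = pls (uce L) (gen L a x) (gen L a y)"
      using a x y unfolding gen_def uce_simps(3)[OF FL_closed(5)[OF a x] FL_closed(5)[OF a y]]
      by (intro cI) (simp_all, unfold Rbil_eq, blast)
  qed (simp add: a)
  moreover have "lin (\<lambda>x. gen L x a) L (uce L)" if a: "a \<in> carr L" for a
  proof (rule linI)
    fix x y c assume x: "x \<in> carr L"
    show "gen L (smul L c x) a = smul (uce L) c (gen L x a)"
      using a x unfolding gen_def uce_simps(4)[OF FL_closed(5)[OF x a]]
      by (intro cI[OF _ _ _ refl]) (simp_all, unfold Rbil_eq, blast)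
    assume y: "y \<in> carr L"
    have "fsub (delta (pls L x y, a)) (fadd (delta (x, a)) (delta (y, a)))
      = fsub (fsub (delta (pls L x y, a)) (delta (x, a))) (delta (y, a))"
      by (auto simp: fsub_def fadd_def algebra_simps)
    then show "gen L (pls L x y) a = pls (uce L) (gen L x a) (gen L y a)"
      using a x y unfolding gen_def uce_simps(3)[OF FL_closed(5)[OF x a] FL_closed(5)[OF y a]]
      by (intro cI) (simp_all, unfold Rbil_eq, blast)
  qed (simp add: a)
  moreover have "gen L (alp L x) (brk L y z) = mns (uce L) (gen L (brk L x y) (alp L z)) (gen L (brk L x z) (alp L y))"
    if x: "x \<in> carr L" "y \<in> carr L" "z \<in> carr L" for x y z
  proof -
    let ?A = "delta (alp L x, brk L y z)" and ?B = "delta (brk L x y, alp L z)" and ?C = "delta (brk L x z, alp L y)"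
    have F: "?A \<in> FL L" "?B \<in> FL L" "?C \<in> FL L" using x by simp_all
    have d: "fsub ?A (fadd ?B (fsmul (-1) ?C)) = fadd (fadd (fsmul (-1) ?B) ?C) ?A"
      by (auto simp: fsub_def fadd_def fsmul_def algebra_simps)
    have m: "fadd (fadd (fsmul (-1) ?B) ?C) ?A \<in> IL L" using x unfolding IL_def by blast
    have "cls L ?A = cls L (fadd ?B (fsmul (-1) ?C))"
      using F by (intro cI[OF _ _ UnI2[OF m] d]) simp_all
    then show ?thesis using F by (simp add: gen_def mns_def neg_def uce_simps)
  qed
  ultimately show ?thesis by (simp add: leibniz_map_def)
qed

lemma lin_gen: "x \<in> carr L \<Longrightarrow> lin (gen L x) L (uce L)" "y \<in> carr L \<Longrightarrow> lin (\<lambda>x. gen L x y) L (uce L)"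
  and gen_leibniz: "x \<in> carr L \<Longrightarrow> y \<in> carr L \<Longrightarrow> z \<in> carr L \<Longrightarrow>
    gen L (alp L x) (brk L y z) = mns (uce L) (gen L (brk L x y) (alp L z)) (gen L (brk L x z) (alp L y))"
  using gen_leibniz_map unfolding leibniz_map_def by meson+

lemma gen_simps:
  assumes "x \<in> carr L" "y \<in> carr L" "z \<in> carr L"
  shows "gen L (pls L x y) z = pls (uce L) (gen L x z) (gen L y z)"
    "gen L z (pls L x y) = pls (uce L) (gen L z x) (gen L z y)"
    "gen L (mns L x y) z = mns (uce L) (gen L x z) (gen L y z)"
    "gen L z (mns L x y) = mns (uce L) (gen L z x) (gen L z y)"
  using assms lin_simps[OF lin_gen(1)[OF assms(3)]] lin_simps[OF lin_gen(2)[OF assms(3)]] by simp_all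

lemma gen_simps':
  assumes "x \<in> carr L" "z \<in> carr L"
  shows "gen L (smul L c x) z = smul (uce L) c (gen L x z)"
    "gen L z (smul L c x) = smul (uce L) c (gen L z x)"
    "gen L (neg L x) z = neg (uce L) (gen L x z)"
    "gen L z (neg L x) = neg (uce L) (gen L z x)"
  using assms lin_simps[OF lin_gen(1)[OF assms(2)]] lin_simps[OF lin_gen(2)[OF assms(2)]]
  by simp_all

lemma gen_zer:
  assumes "z \<in> carr L"
  shows "gen L (zer L) z = zer (uce L)" "gen L z (zer L) = zer (uce L)"
  using lin_zer[OF lin_gen(1)[OF assms]] lin_zer[OF lin_gen(2)[OF assms]] by simp_all

lemma brk_simps:
  assumes "x \<in> carr L" "y \<in> carr L" "z \<in> carr L"
  shows "brk L (pls L x y) z = pls L (brk L x z) (brk L y z)"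
    "brk L z (pls L x y) = pls L (brk L z x) (brk L z y)"
    "brk L (mns L x y) z = mns L (brk L x z) (brk L y z)"
    "brk L z (mns L x y) = mns L (brk L z x) (brk L z y)"
  using assms lin_simps[OF lin_brk(1)[OF assms(3)]] lin_simps[OF lin_brk(2)[OF assms(3)]] by simp_all

lemma brk_simps':
  assumes "x \<in> carr L" "z \<in> carr L"
  shows "brk L (smul L c x) z = smul L c (brk L x z)"
    "brk L z (smul L c x) = smul L c (brk L z x)"
    "brk L (neg L x) z = neg L (brk L x z)"
    "brk L z (neg L x) = neg L (brk L z x)"
  using assms lin_simps[OF lin_brk(1)[OF assms(2)]] lin_simps[OF lin_brk(2)[OF assms(2)]]
  by simp_all

lemma brk_zer:
  assumes "z \<in> carr L"
  shows "brk L (zer L) z = zer L" "brk L z (zer L) = zer L"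
  using lin_zer[OF lin_brk(1)[OF assms]] lin_zer[OF lin_brk(2)[OF assms]] by simp_all

text \<open>The closure conditions are bundled into \<open>subspace\<close>, which fits the uses
  below: equalisers of linear maps and sums of images.\<close>

lemma uce_induct [consumes 1, case_names subspace gen]:
  assumes X: "X \<in> carr (uce L)" and A: "subspace (uce L) A"
    and gen: "\<And>a b. a \<in> carr L \<Longrightarrow> b \<in> carr L \<Longrightarrow> gen L a b \<in> A"
  shows "X \<in> A"
proof -
  obtain f where f: "X = cls L f" "f \<in> FL L" using X by (auto simp: uce_simps)
  from f(2) have "cls L f \<in> A"
  proof (induction rule: FL_induct)
    case zero then show ?case using A by (simp add: subspace_def flip: uce_simps)
  next
    case (delta a b) then show ?case using gen by (simp add: gen_def)
  next
    case (add f g) then show ?case using A unfolding subspace_def by (metis uce_simps(3))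
  next
    case (smul c f) then show ?case using A unfolding subspace_def by (metis uce_simps(4))
  qed
  then show ?thesis using f by simp
qed

lemma uce_lin_eqI:
  assumes X: "X \<in> carr (uce L)" and f: "lin f (uce L) W" and g: "lin g (uce L) W" and W: "vs W"
    and eq: "\<And>a b. a \<in> carr L \<Longrightarrow> b \<in> carr L \<Longrightarrow> f (gen L a b) = g (gen L a b)"
  shows "f X = g X"
proof -
  have "X \<in> {X \<in> carr (uce L). f X = g X}"
    using X by (rule uce_induct) (auto simp: subspace_def lin_simps[OF f] lin_simps[OF g] lin_zer[OF f _ W] lin_zer[OF g _ W] eq)
  then show ?thesis by simp
qed

text \<open>Counterpart of \<open>functional_lift\<close>: any functional on \<open>uce L\<close>
  can be evaluated on a concrete free vector, such as those that \<open>push\<close> and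
  \<open>fbr\<close> produce.\<close>

lemma functional_cls:
  assumes \<phi>: "lin \<phi> (uce L) scal" and f: "f \<in> FL L"
  shows "\<phi> (cls L f) = ext (\<lambda>a b. \<phi> (gen L a b)) f"
  using f
proof (induction rule: FL_induct)
  case zero then show ?case using functional_simps(1)[OF \<phi>] by (simp add: uce_simps)
next
  case (add f g)
  then show ?case using functional_simps(2)[OF \<phi>, of "cls L f" "cls L g"]
    by (simp add: uce_simps ext_fadd FL_finite)
next
  case (smul c f)
  then show ?case using functional_simps(3)[OF \<phi>, of "cls L f"]
    by (simp add: uce_simps ext_fsmul FL_finite)
qed (simp add: gen_def)

section \<open>The map to the base algebra and the bracket of the extension\<close>

lemma Uce_eq_lift: "Uce L = lift L (brk L)"
  by (simp add: Uce_def lift_def fun_eq_iff)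

lemma brk_leibniz_map: "leibniz_map L (brk L)"
  by (simp add: leibniz_map_def lin_brk leibniz)

lemma lin_Uce: "lin (Uce L) (uce L) L"
  unfolding Uce_eq_lift by (intro lin_lift brk_leibniz_map) simp

lemma Uce_gen [simp]: "a \<in> carr L \<Longrightarrow> b \<in> carr L \<Longrightarrow> Uce L (gen L a b) = brk L a b"
  unfolding Uce_eq_lift by (intro lift_gen brk_leibniz_map) simp_all

lemma Uce_closed [simp]: "X \<in> carr (uce L) \<Longrightarrow> Uce L X \<in> carr L"
  by (rule lin_closed[OF lin_Uce])

lemma fbr_FL [simp]:
  assumes "f \<in> FL L" "g \<in> FL L"
  shows "fbr L f g \<in> FL L"
  unfolding FL_eq
proof (intro CollectI conjI)
  let ?B = "\<lambda>(p, q). (brk L (fst p) (snd p), brk L (fst q) (snd q))"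
  show "finite (supp (fbr L f g))"
    using assms by (intro finite_subset[OF supp_fbr]) (simp add: FL_finite)
  have fg: "supp f \<subseteq> carr L \<times> carr L" "supp g \<subseteq> carr L \<times> carr L"
    using assms by (simp_all add: FL_eq)
  have "?B (p, q) \<in> carr L \<times> carr L" if "p \<in> supp f" "q \<in> supp g" for p q
    using subsetD[OF fg(1) that(1)] subsetD[OF fg(2) that(2)] by auto
  then have "?B ` (supp f \<times> supp g) \<subseteq> carr L \<times> carr L" by auto
  with supp_fbr show "supp (fbr L f g) \<subseteq> carr L \<times> carr L" by (rule subset_trans)
qed

text \<open>Under a functional, expanding \<open>Uce L X\<close> and then \<open>Uce L Y\<close>
  inside \<open>gen\<close> produces the double sum of \<open>ext_fbr\<close>. So the bracket is
  independent of representatives and sees its arguments only through \<open>Uce L\<close>.\<close>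

lemma brk_uce:
  assumes "X \<in> carr (uce L)" "Y \<in> carr (uce L)"
  shows "brk (uce L) X Y = gen L (Uce L X) (Uce L Y)"
proof -
  obtain f g where fg: "X = cls L f" "Y = cls L g" "f \<in> FL L" "g \<in> FL L"
    using assms by (auto simp: uce_simps)
  let ?f = "rep X" and ?g = "rep Y"
  have FL: "?f \<in> FL L" "?g \<in> FL L" and cls: "cls L ?f = X" "cls L ?g = Y"
    using fg by (simp_all add: rep_cls)
  have "cls L (fbr L ?f ?g) = gen L (Uce L X) (Uce L Y)"
  proof (rule vs_eqI[OF vs_uce])
    fix \<phi> assume \<phi>: "lin \<phi> (uce L) scal"
    \<comment> \<open>Fixing one slot of \<open>gen\<close> leaves a functional on \<open>L\<close>,
      to which \<open>functional_lift\<close> for the bracket applies.\<close>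
    have l1: "lin (\<lambda>v. \<phi> (gen L u v)) L scal" if "u \<in> carr L" for u
      using that by (intro lin_comp[OF lin_gen(1) \<phi>])
    have l2: "lin (\<lambda>u. \<phi> (gen L u (Uce L Y))) L scal"
      using assms by (intro lin_comp[OF lin_gen(2) \<phi>]) simp
    have "\<phi> (gen L (Uce L X) (Uce L Y)) = ext (\<lambda>a b. \<phi> (gen L (brk L a b) (Uce L Y))) ?f"
      using functional_lift(2)[OF brk_leibniz_map vs_L FL(1) l2] by (simp add: cls Uce_eq_lift)
    also have "\<dots> = ext (\<lambda>a b. ext (\<lambda>a' b'. \<phi> (gen L (brk L a b) (brk L a' b'))) ?g) ?f"
      unfolding ext_def[of _ ?f]
    proof (intro sum.cong refl arg_cong2[of _ _ _ _ "(*)"])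
      fix p assume "p \<in> supp ?f"
      then have "brk L (fst p) (snd p) \<in> carr L" using FL(1) by (auto simp: FL_eq)
      from functional_lift(2)[OF brk_leibniz_map vs_L FL(2) l1[OF this]]
      show "\<phi> (gen L (brk L (fst p) (snd p)) (Uce L Y)) =
        ext (\<lambda>a' b'. \<phi> (gen L (brk L (fst p) (snd p)) (brk L a' b'))) ?g"
        by (simp add: cls Uce_eq_lift)
    qed
    also have "\<dots> = \<phi> (cls L (fbr L ?f ?g))" using FL by (simp add: functional_cls[OF \<phi>] ext_fbr FL_finite)
    finally show "\<phi> (cls L (fbr L ?f ?g)) = \<phi> (gen L (Uce L X) (Uce L Y))" ..
  qed (use FL assms in simp_all)
  then show ?thesis by (simp add: uce_def)
qed

text \<open>Each bracket is the value at a generator, and brackets span \<open>L\<close> by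
  perfectness. This provides the lifts along \<open>Uce\<close> used throughout for M and Q.\<close>

lemma Uce_surj: "Uce L ` carr (uce L) = carr L"
proof
  have "subspace L (Uce L ` carr (uce L))"
    by (intro subspace_image[OF lin_Uce] subspace_carrier) simp_all
  moreover have "{brk L x y | x y. x \<in> carr L \<and> y \<in> carr L} \<subseteq> Uce L ` carr (uce L)"
  proof clarify
    fix x y assume "x \<in> carr L" "y \<in> carr L"
    then show "brk L x y \<in> Uce L ` carr (uce L)" by (intro image_eqI[of _ _ "gen L x y"]) simp_all
  qed
  ultimately have "span_in L {brk L x y | x y. x \<in> carr L \<and> y \<in> carr L} \<subseteq> Uce L ` carr (uce L)"
    by (rule span_in_subset)
  then show "carr L \<subseteq> Uce L ` carr (uce L)" by (rule ord_eq_le_trans[OF carr_span_brk])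
qed auto

end

section \<open>Functoriality of the extension\<close>

lemma push_FL:
  assumes "perfect_hom_leibniz L" "perfect_hom_leibniz L'" "lin g L L'" "f \<in> FL L"
  shows "push (map_prod g g) f \<in> FL L'"
  unfolding perfect_hom_leibniz.FL_eq[OF assms(2)]
proof (intro CollectI conjI)
  have f: "finite (supp f)" "supp f \<subseteq> carr L \<times> carr L"
    using assms(4) by (simp_all add: perfect_hom_leibniz.FL_eq[OF assms(1)])
  show "finite (supp (push (map_prod g g) f))"
    using f by (intro finite_subset[OF supp_push]) simp
  have "map_prod g g p \<in> carr L' \<times> carr L'" if "p \<in> supp f" for p
    using subsetD[OF f(2) that] lin_closed[OF assms(3)] by auto
  then have "map_prod g g ` supp f \<subseteq> carr L' \<times> carr L'" by (rule image_subsetI)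
  with supp_push show "supp (push (map_prod g g) f) \<subseteq> carr L' \<times> carr L'" by (rule subset_trans)
qed

locale perfect_hom = L: perfect_hom_leibniz L + L': perfect_hom_leibniz L'
  for L :: "('k::field, 'a) hla" and L' :: "('k, 'b) hla" +
  fixes g :: "'a \<Rightarrow> 'b"
  assumes hom: "hom g L L'"
begin

lemma lin_g: "lin g L L'"
  using hom by (simp add: hom_def)

lemma g_closed [simp]: "x \<in> carr L \<Longrightarrow> g x \<in> carr L'"
  by (rule lin_closed[OF lin_g])

lemma g_brk: "x \<in> carr L \<Longrightarrow> y \<in> carr L \<Longrightarrow> g (brk L x y) = brk L' (g x) (g y)"
  and g_alp: "x \<in> carr L \<Longrightarrow> g (alp L x) = alp L' (g x)"
  using hom by (simp_all add: hom_def)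

lemma gen_leibniz_map: "L.leibniz_map (uce L') (\<lambda>a b. gen L' (g a) (g b))"
  unfolding L.leibniz_map_def
  by (auto intro!: lin_comp[OF lin_g] L'.lin_gen simp: g_brk g_alp L'.gen_leibniz)

text \<open>\<open>uce_map\<close> pushes a representative forward. Recognising it as a lift of a
  Leibniz form makes linearity and the value on generators consequences of the universal
  property.\<close>

lemma uce_map_cls:
  assumes f: "f \<in> FL L"
  shows "uce_map g L L' (cls L f) = lift (uce L') (\<lambda>a b. gen L' (g a) (g b)) (cls L f)"
proof (rule vs_eqI[OF L'.vs_uce])
  note p = push_FL[OF L.perfect_hom_leibniz_axioms L'.perfect_hom_leibniz_axioms lin_g L.rep_cls(1)[OF f]]
  then show "uce_map g L L' (cls L f) \<in> carr (uce L')"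
    by (simp add: uce_map_def L'.uce_simps)
  note lift = L.functional_lift[OF gen_leibniz_map L'.vs_uce f]
  show "lift (uce L') (\<lambda>a b. gen L' (g a) (g b)) (cls L f) \<in> carr (uce L')" by (rule lift)
  fix \<phi> assume \<phi>: "lin \<phi> (uce L') scal"
  show "\<phi> (uce_map g L L' (cls L f)) = \<phi> (lift (uce L') (\<lambda>a b. gen L' (g a) (g b)) (cls L f))"
    using L.ext_rep[OF L.leibniz_map_comp[OF gen_leibniz_map \<phi> L'.vs_uce] f] L.rep_cls(1)[OF f]
    by (simp add: lift(2)[OF \<phi>] uce_map_def L'.functional_cls[OF \<phi> p] ext_push L.FL_finite)
qed

lemma uce_map_eq: "X \<in> carr (uce L) \<Longrightarrow>
    uce_map g L L' X = lift (uce L') (\<lambda>a b. gen L' (g a) (g b)) X"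
  using uce_map_cls by (auto simp: L.uce_simps)

lemma lin_uce_map: "lin (uce_map g L L') (uce L) (uce L')"
  using L.lin_lift[OF gen_leibniz_map L'.vs_uce]
  by (simp add: lin_def uce_map_eq)

lemma uce_map_closed [simp]: "X \<in> carr (uce L) \<Longrightarrow> uce_map g L L' X \<in> carr (uce L')"
  by (rule lin_closed[OF lin_uce_map])

lemma uce_map_gen [simp]: "a \<in> carr L \<Longrightarrow> b \<in> carr L \<Longrightarrow> uce_map g L L' (gen L a b) = gen L' (g a) (g b)"
  by (simp add: uce_map_eq L.lift_gen[OF gen_leibniz_map])

lemma Uce_uce_map: "X \<in> carr (uce L) \<Longrightarrow> Uce L' (uce_map g L L' X) = g (Uce L X)"
  by (rule L.uce_lin_eqI[OF _ lin_comp[OF lin_uce_map L'.lin_Uce] lin_comp[OF L.lin_Uce lin_g]])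
    (simp_all add: g_brk)

lemma uce_map_brk: "X \<in> carr (uce L) \<Longrightarrow> Y \<in> carr (uce L) \<Longrightarrow>
    uce_map g L L' (brk (uce L) X Y) = brk (uce L') (uce_map g L L' X) (uce_map g L L' Y)"
  by (simp add: L.brk_uce L'.brk_uce Uce_uce_map)

end

text \<open>The structure map is itself an endomorphism, so that \<open>alp (uce L)\<close> inherits
  all facts on \<open>uce_map\<close>.\<close>

sublocale perfect_hom_leibniz \<subseteq> alp: perfect_hom L L "alp L"
  by unfold_locales (simp add: hom_def lin_alp alp_brk)

context perfect_hom_leibniz
begin

lemma alp_uce: "alp (uce L) = uce_map (alp L) L L"
  by (simp add: uce_def uce_map_def fun_eq_iff)

lemma lin_alp_uce: "lin (alp (uce L)) (uce L) (uce L)"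
  unfolding alp_uce by (rule alp.lin_uce_map)

lemma alp_uce_gen [simp]: "a \<in> carr L \<Longrightarrow> b \<in> carr L \<Longrightarrow> alp (uce L) (gen L a b) = gen L (alp L a) (alp L b)"
  by (simp add: alp_uce)

lemma alp_uce_closed [simp]: "X \<in> carr (uce L) \<Longrightarrow> alp (uce L) X \<in> carr (uce L)"
  by (simp add: alp_uce)

lemma Uce_alp: "X \<in> carr (uce L) \<Longrightarrow> Uce L (alp (uce L) X) = alp L (Uce L X)"
  by (simp add: alp_uce alp.Uce_uce_map)

lemma Uce_brk: "X \<in> carr (uce L) \<Longrightarrow> Y \<in> carr (uce L) \<Longrightarrow> Uce L (brk (uce L) X Y) = brk L (Uce L X) (Uce L Y)"
  by (simp add: brk_uce)

lemma lin_brk_uce: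
  assumes X: "X \<in> carr (uce L)"
  shows "lin (brk (uce L) X) (uce L) (uce L)" "lin (\<lambda>Y. brk (uce L) Y X) (uce L) (uce L)"
  using lin_comp[OF lin_Uce lin_gen(1)[OF Uce_closed[OF X]]]
    lin_comp[OF lin_Uce lin_gen(2)[OF Uce_closed[OF X]]] X
  by (simp_all add: lin_def brk_uce)

text \<open>By \<open>brk_uce\<close> the Leibniz identity at X, Y, Z is the defining relation at
  their images under \<open>Uce L\<close>.\<close>

lemma hom_leibniz_uce: "hom_leibniz (uce L)"
  unfolding hom_leibniz_def
  by (intro conjI ballI lin_brk_uce lin_alp_uce vs_uce)
    (simp_all add: brk_uce gen_leibniz Uce_alp)

end

lemma (in perfect_hom) hom_uce_map: "hom (uce_map g L L') (uce L) (uce L')"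
proof -
  have "uce_map g L L' (alp (uce L) X) = alp (uce L') (uce_map g L L' X)" if "X \<in> carr (uce L)" for X
    using that
    by (rule L.uce_lin_eqI[OF _ lin_comp[OF L.lin_alp_uce lin_uce_map] lin_comp[OF lin_uce_map L'.lin_alp_uce]])
      (simp_all add: g_alp)
  then show ?thesis by (simp add: hom_def lin_uce_map uce_map_brk)
qed

section \<open>Split extensions with symmetric action\<close>

locale symmetric_split_extension =
  M: perfect_hom_leibniz M + G: perfect_hom_leibniz G + Q: perfect_hom_leibniz Q +
  t: perfect_hom M G t + p: perfect_hom G Q p + s: perfect_hom Q G s
  for M :: "('k::field, 'm) hla" and G :: "('k, 'g) hla" and Q :: "('k, 'q) hla"
    and t :: "'m \<Rightarrow> 'g" and p :: "'g \<Rightarrow> 'q" and s :: "'q \<Rightarrow> 'g" +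
  assumes alp_Q: "q \<in> carr Q \<Longrightarrow> alp Q q = q"
    and t_inj: "inj_on t (carr M)"
    and exact: "t ` carr M = ker p G Q"
    and split: "q \<in> carr Q \<Longrightarrow> p (s q) = q"
    and symm: "q \<in> carr Q \<Longrightarrow> m \<in> carr M \<Longrightarrow> pls M (ind_l M G t s q m) (ind_r M G t s m q) = zer M"
begin

abbreviation D :: "'q \<Rightarrow> 'm \<Rightarrow> 'm" where "D \<equiv> ind_l M G t s"

abbreviation "\<tau> \<equiv> uce_map t M G"
abbreviation "\<sigma> \<equiv> uce_map s Q G"
abbreviation "\<pi> \<equiv> uce_map p G Q"

section \<open>The action of Q on M computed inside G\<close>

lemma t_eqI: "m \<in> carr M \<Longrightarrow> n \<in> carr M \<Longrightarrow> t m = t n \<Longrightarrow> m = n"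
  using t_inj by (rule inj_onD)

lemma p_t: "m \<in> carr M \<Longrightarrow> p (t m) = zer Q"
  using exact by (auto simp: ker_def)

lemma t_the_inv: assumes "g \<in> carr G" "p g = zer Q"
  shows "the_inv_into (carr M) t g \<in> carr M" "t (the_inv_into (carr M) t g) = g"
proof -
  have "g \<in> t ` carr M" using assms exact by (simp add: ker_def)
  then show "the_inv_into (carr M) t g \<in> carr M" "t (the_inv_into (carr M) t g) = g"
    using t_inj by (auto simp: f_the_inv_into_f intro: the_inv_into_into)
qed

text \<open>The preimages in \<open>ind_l\<close> and \<open>ind_r\<close> are meaningful because p
  (t m) = 0 puts both brackets into Ker p. \<open>brk_t_s\<close> is symmetry transported to G, the
  form in which it is used below.\<close>

lemma
  assumes q: "q \<in> carr Q" and m: "m \<in> carr M"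
  shows D_closed [simp]: "D q m \<in> carr M" and t_D: "t (D q m) = brk G (s q) (t m)"
    and ind_r_eq: "ind_r M G t s m q = neg M (D q m)"
    and brk_t_s: "brk G (t m) (s q) = neg G (brk G (s q) (t m))"
proof -
  have pl: "p (brk G (s q) (t m)) = zer Q" and pr: "p (brk G (t m) (s q)) = zer Q"
    using q m by (simp_all add: p.g_brk p_t Q.brk_zer split)
  show D: "D q m \<in> carr M" "t (D q m) = brk G (s q) (t m)"
    using q m t_the_inv[OF _ pl] by (simp_all add: ind_l_def)
  have r: "ind_r M G t s m q \<in> carr M" "t (ind_r M G t s m q) = brk G (t m) (s q)"
    using q m t_the_inv[OF _ pr] by (simp_all add: ind_r_def)
  show eq: "ind_r M G t s m q = neg M (D q m)"
  proof (rule vs_eqI[OF M.vs_L])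
    fix \<phi> assume \<phi>: "lin \<phi> M scal"
    have "\<phi> (D q m) + \<phi> (ind_r M G t s m q) = 0"
      using arg_cong[OF symm[OF q m], of \<phi>] D r by (simp add: functional_simps[OF \<phi>])
    then show "\<phi> (ind_r M G t s m q) = \<phi> (neg M (D q m))"
      using D by (simp add: functional_simps[OF \<phi>] add_eq_0_iff)
  qed (use D r in simp_all)
  show "brk G (t m) (s q) = neg G (brk G (s q) (t m))"
    using D lin_neg[OF t.lin_g D(1)] r(2) by (simp add: eq)
qed

lemmas t_simps = lin_simps[OF t.lin_g] lin_zer[OF t.lin_g M.vs_L G.vs_L]
lemmas s_simps = lin_simps[OF s.lin_g] lin_zer[OF s.lin_g Q.vs_L G.vs_L]
lemmas p_simps = lin_simps[OF p.lin_g] lin_zer[OF p.lin_g G.vs_L Q.vs_L]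

lemma alp_s: "q \<in> carr Q \<Longrightarrow> alp G (s q) = s q"
  by (simp add: alp_Q flip: s.g_alp)

text \<open>As t is injective and carries D q to the bracket with s q, identities for D are verified
  in G.\<close>

lemma lin_D: "q \<in> carr Q \<Longrightarrow> lin (D q) M M" "m \<in> carr M \<Longrightarrow> lin (\<lambda>q. D q m) Q M"
  by (rule linI; (rule t_eqI)?; simp add: t_D t_simps s_simps G.brk_simps G.brk_simps')+

lemma alp_D: "q \<in> carr Q \<Longrightarrow> m \<in> carr M \<Longrightarrow> alp M (D q m) = D q (alp M m)"
  by (rule t_eqI) (simp_all add: t_D t.g_alp G.alp_brk alp_s)

text \<open>The Leibniz identity of G with s q in the first place, where \<alpha>(s q) = s q. Its
  lift to \<open>uce M\<close> is \<open>actl\<close>.\<close>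

lemma D_brk:
  assumes "q \<in> carr Q" "m \<in> carr M" "n \<in> carr M"
  shows "D q (brk M m n) = mns M (brk M (D q m) (alp M n)) (brk M (D q n) (alp M m))"
  by (rule t_eqI)
    (use assms G.leibniz[of "s q" "t m" "t n"] in \<open>simp_all add: t_D t_simps t.g_brk t.g_alp alp_s\<close>)

text \<open>The Leibniz identity of G with s q in the last place; symmetry then moves s q to the
  left in all three terms. The lift of its negative is \<open>actr\<close>.\<close>

lemma D_deriv:
  assumes "q \<in> carr Q" "m \<in> carr M" "n \<in> carr M"
  shows "D q (brk M m n) = pls M (brk M (D q m) (alp M n)) (brk M (alp M m) (D q n))"
proof (rule t_eqI)
  have "brk G (s q) (brk G (t m) (t n)) =
    pls G (brk G (brk G (s q) (t m)) (alp G (t n))) (brk G (alp G (t m)) (brk G (s q) (t n)))"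
  proof (rule vs_eqI[OF G.vs_L])
    fix \<phi> assume \<phi>: "lin \<phi> G scal"
    have "brk G (brk G (t m) (t n)) (s q) = neg G (brk G (s q) (brk G (t m) (t n)))"
      using assms brk_t_s[of q "brk M m n"] by (simp add: t.g_brk)
    then show "\<phi> (brk G (s q) (brk G (t m) (t n))) =
      \<phi> (pls G (brk G (brk G (s q) (t m)) (alp G (t n))) (brk G (alp G (t m)) (brk G (s q) (t n))))"
      using assms arg_cong[OF G.leibniz[of "t m" "t n" "s q"], of \<phi>]
      by (simp add: brk_t_s alp_s G.brk_simps' functional_simps[OF \<phi>] algebra_simps)
  qed (use assms in simp_all)
  then show "t (D q (brk M m n)) = t (pls M (brk M (D q m) (alp M n)) (brk M (alp M m) (D q n)))"
    using assms by (simp add: t_D t_simps t.g_brk t.g_alp)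
qed (use assms in simp_all)

text \<open>The Leibniz identity at s q, s q', t m, with symmetry applied to its last term
  [[s q, t m], s q'].\<close>

lemma D_comm:
  assumes "q \<in> carr Q" "q' \<in> carr Q" "m \<in> carr M"
  shows "D (brk Q q q') (alp M m) = mns M (D q (D q' m)) (D q' (D q m))"
proof (rule t_eqI)
  have "brk G (brk G (s q) (s q')) (alp G (t m)) =
    mns G (brk G (s q) (brk G (s q') (t m))) (brk G (s q') (brk G (s q) (t m)))"
  proof (rule vs_eqI[OF G.vs_L])
    fix \<phi> assume \<phi>: "lin \<phi> G scal"
    have "brk G (brk G (s q) (t m)) (s q') = neg G (brk G (s q') (brk G (s q) (t m)))"
      using assms brk_t_s[of q' "D q m"] by (simp add: t_D)
    then show "\<phi> (brk G (brk G (s q) (s q')) (alp G (t m))) =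
      \<phi> (mns G (brk G (s q) (brk G (s q') (t m))) (brk G (s q') (brk G (s q) (t m))))"
      using assms arg_cong[OF G.leibniz[of "s q" "s q'" "t m"], of \<phi>]
      by (simp add: alp_s functional_simps[OF \<phi>] algebra_simps)
  qed (use assms in simp_all)
  then show "t (D (brk Q q q') (alp M m)) = t (mns M (D q (D q' m)) (D q' (D q m)))"
    using assms by (simp add: t_D t_simps t.g_alp s.g_brk)
qed (use assms in simp_all)

text \<open>The action of \<open>uce Q\<close> factors through \<open>Uce Q\<close>, so it suffices to let \<open>Q\<close> act on \<open>uce M\<close>:
  \<open>actl q\<close> is \<open>q \<cdot> _\<close> and \<open>actr q\<close> is \<open>_ \<cdot> q\<close>, where \<open>m \<cdot> q = - D q m\<close> by symmetry.\<close>

definition actl :: "'q \<Rightarrow> ('m \<times> 'm \<Rightarrow> 'k) set \<Rightarrow> ('m \<times> 'm \<Rightarrow> 'k) set" where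
  "actl q = lift (uce M) (\<lambda>m n. mns (uce M) (gen M (D q m) (alp M n)) (gen M (D q n) (alp M m)))"

definition actr :: "'q \<Rightarrow> ('m \<times> 'm \<Rightarrow> 'k) set \<Rightarrow> ('m \<times> 'm \<Rightarrow> 'k) set" where
  "actr q = lift (uce M) (\<lambda>m n. mns (uce M) (gen M (neg M (D q m)) (alp M n)) (gen M (alp M m) (D q n)))"

lemmas D_lin_simps = lin_simps[OF lin_D(1)] lin_zer[OF lin_D(1) M.vs_L M.vs_L]

text \<open>\<open>D_brk\<close> and the relation of \<open>uce M\<close> reduce both sides to terms
  {[D u, \<alpha> v], \<alpha>\<alpha> w}, which then agree. \<open>alp_D\<close> is used from right
  to left, since the relation needs \<alpha> outermost in the first slot.\<close>

lemma actl_leibniz_map: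
  assumes q: "q \<in> carr Q"
  shows "M.leibniz_map (uce M) (\<lambda>m n. mns (uce M) (gen M (D q m) (alp M n)) (gen M (D q n) (alp M m)))"
  unfolding M.leibniz_map_def
proof (intro conjI ballI)
  fix x assume x: "x \<in> carr M"
  show "lin (\<lambda>n. mns (uce M) (gen M (D q x) (alp M n)) (gen M (D q n) (alp M x))) M (uce M)"
    "lin (\<lambda>n. mns (uce M) (gen M (D q n) (alp M x)) (gen M (D q x) (alp M n))) M (uce M)"
    using x q by (auto intro!: lin_mns_fun lin_comp[OF M.lin_alp M.lin_gen(1)] lin_comp[OF lin_D(1) M.lin_gen(2)])
  fix y z assume y: "y \<in> carr M" and z: "z \<in> carr M"
  show "mns (uce M) (gen M (D q (alp M x)) (alp M (brk M y z))) (gen M (D q (brk M y z)) (alp M (alp M x))) =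
    mns (uce M)
      (mns (uce M) (gen M (D q (brk M x y)) (alp M (alp M z))) (gen M (D q (alp M z)) (alp M (brk M x y))))
      (mns (uce M) (gen M (D q (brk M x z)) (alp M (alp M y))) (gen M (D q (alp M y)) (alp M (brk M x z))))"
  proof (rule vs_eqI[OF M.vs_uce])
    fix \<phi> assume \<phi>: "lin \<phi> (uce M) scal"
    show "\<phi> (mns (uce M) (gen M (D q (alp M x)) (alp M (brk M y z))) (gen M (D q (brk M y z)) (alp M (alp M x)))) =
    \<phi> (mns (uce M)
      (mns (uce M) (gen M (D q (brk M x y)) (alp M (alp M z))) (gen M (D q (alp M z)) (alp M (brk M x y))))
      (mns (uce M) (gen M (D q (brk M x z)) (alp M (alp M y))) (gen M (D q (alp M y)) (alp M (brk M x z)))))"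
      using q x y z
      by (simp add: functional_simps[OF \<phi>] D_brk M.gen_simps M.gen_leibniz M.alp_brk flip: alp_D)
  qed (use q x y z in simp_all)
qed

text \<open>The same reduction, with the derivation rule \<open>D_deriv\<close> expanding D q of a
  bracket in either slot.\<close>

lemma actr_leibniz_map:
  assumes q: "q \<in> carr Q"
  shows "M.leibniz_map (uce M) (\<lambda>m n. mns (uce M) (gen M (neg M (D q m)) (alp M n)) (gen M (alp M m) (D q n)))"
  unfolding M.leibniz_map_def
proof (intro conjI ballI)
  have nD: "lin (\<lambda>m. neg M (D q m)) M M"
    using q by (auto intro!: linI simp: D_lin_simps neg_def smul_pls smul_smul mult.commute)
  fix x assume x: "x \<in> carr M"
  show "lin (\<lambda>n. mns (uce M) (gen M (neg M (D q x)) (alp M n)) (gen M (alp M x) (D q n))) M (uce M)"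
    "lin (\<lambda>n. mns (uce M) (gen M (neg M (D q n)) (alp M x)) (gen M (alp M n) (D q x))) M (uce M)"
    using x q by (auto intro!: lin_mns_fun lin_comp[OF M.lin_alp M.lin_gen(1)] lin_comp[OF lin_D(1) M.lin_gen(1)]
      lin_comp[OF nD M.lin_gen(2)] lin_comp[OF M.lin_alp M.lin_gen(2)])
  fix y z assume y: "y \<in> carr M" and z: "z \<in> carr M"
  show "mns (uce M) (gen M (neg M (D q (alp M x))) (alp M (brk M y z))) (gen M (alp M (alp M x)) (D q (brk M y z))) =
    mns (uce M)
      (mns (uce M) (gen M (neg M (D q (brk M x y))) (alp M (alp M z))) (gen M (alp M (brk M x y)) (D q (alp M z))))
      (mns (uce M) (gen M (neg M (D q (brk M x z))) (alp M (alp M y))) (gen M (alp M (brk M x z)) (D q (alp M y))))"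
  proof (rule vs_eqI[OF M.vs_uce])
    fix \<phi> assume \<phi>: "lin \<phi> (uce M) scal"
    show "\<phi> (mns (uce M) (gen M (neg M (D q (alp M x))) (alp M (brk M y z))) (gen M (alp M (alp M x)) (D q (brk M y z)))) =
    \<phi> (mns (uce M)
      (mns (uce M) (gen M (neg M (D q (brk M x y))) (alp M (alp M z))) (gen M (alp M (brk M x y)) (D q (alp M z))))
      (mns (uce M) (gen M (neg M (D q (brk M x z))) (alp M (alp M y))) (gen M (alp M (brk M x z)) (D q (alp M y)))))"
      using q x y z
      by (simp add: functional_simps[OF \<phi>] D_deriv M.gen_simps M.gen_simps' M.gen_leibniz M.alp_brk flip: alp_D)
  qed (use q x y z in simp_all)
qed

lemma
  assumes q: "q \<in> carr Q"
  shows lin_actl: "lin (actl q) (uce M) (uce M)" and lin_actr: "lin (actr q) (uce M) (uce M)"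
    and actl_gen: "m \<in> carr M \<Longrightarrow> n \<in> carr M \<Longrightarrow>
      actl q (gen M m n) = mns (uce M) (gen M (D q m) (alp M n)) (gen M (D q n) (alp M m))"
    and actr_gen: "m \<in> carr M \<Longrightarrow> n \<in> carr M \<Longrightarrow>
      actr q (gen M m n) = mns (uce M) (gen M (neg M (D q m)) (alp M n)) (gen M (alp M m) (D q n))"
  unfolding actl_def actr_def
  by (intro M.lin_lift actl_leibniz_map actr_leibniz_map M.vs_uce q
    M.lift_gen[OF actl_leibniz_map] M.lift_gen[OF actr_leibniz_map]; assumption)+

lemma act_closed [simp]:
  "q \<in> carr Q \<Longrightarrow> x \<in> carr (uce M) \<Longrightarrow> actl q x \<in> carr (uce M)"
  "q \<in> carr Q \<Longrightarrow> x \<in> carr (uce M) \<Longrightarrow> actr q x \<in> carr (uce M)"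
  by (rule lin_closed[OF lin_actl] lin_closed[OF lin_actr]; assumption)+

lemmas actl_simps = lin_simps[OF lin_actl] lin_zer[OF lin_actl M.vs_uce M.vs_uce]
lemmas actr_simps = lin_simps[OF lin_actr] lin_zer[OF lin_actr M.vs_uce M.vs_uce]

text \<open>The elements x on which the action is linear in q form a subspace, so generators
  suffice.\<close>

lemma lin_act_left:
  assumes x: "x \<in> carr (uce M)"
  shows "lin (\<lambda>q. actl q x) Q (uce M)" "lin (\<lambda>q. actr q x) Q (uce M)"
proof -
  have nD: "lin (\<lambda>q. neg M (D q m)) Q M" if "m \<in> carr M" for m
    using that lin_pls[OF lin_D(2)[OF that]] lin_smul[OF lin_D(2)[OF that]]
    by (auto intro!: linI simp: neg_def smul_pls smul_smul mult.commute)
  have sub: "subspace (uce M) {x \<in> carr (uce M). lin (\<lambda>q. f q x) Q (uce M)}"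
    if f: "\<And>q. q \<in> carr Q \<Longrightarrow> lin (f q) (uce M) (uce M)" for f
    unfolding subspace_def
    by (auto simp: lin_def lin_simps[OF f] lin_zer[OF f M.vs_uce M.vs_uce] pls_ac smul_pls smul_smul mult.commute)
  have "x \<in> {x \<in> carr (uce M). lin (\<lambda>q. actl q x) Q (uce M)}"
    using x
  proof (rule M.uce_induct)
    fix m n assume mn: "m \<in> carr M" "n \<in> carr M"
    have "lin (\<lambda>q. mns (uce M) (gen M (D q m) (alp M n)) (gen M (D q n) (alp M m))) Q (uce M)"
      using mn by (auto intro!: lin_mns_fun lin_comp[OF lin_D(2) M.lin_gen(2)])
    then show "gen M m n \<in> {x \<in> carr (uce M). lin (\<lambda>q. actl q x) Q (uce M)}"
      using mn by (simp add: lin_def actl_gen)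
  qed (rule sub[OF lin_actl])
  then show "lin (\<lambda>q. actl q x) Q (uce M)" by simp
  have "x \<in> {x \<in> carr (uce M). lin (\<lambda>q. actr q x) Q (uce M)}"
    using x
  proof (rule M.uce_induct)
    fix m n assume mn: "m \<in> carr M" "n \<in> carr M"
    have "lin (\<lambda>q. mns (uce M) (gen M (neg M (D q m)) (alp M n)) (gen M (alp M m) (D q n))) Q (uce M)"
      using mn by (auto intro!: lin_mns_fun lin_comp[OF nD M.lin_gen(2)] lin_comp[OF lin_D(2) M.lin_gen(1)])
    then show "gen M m n \<in> {x \<in> carr (uce M). lin (\<lambda>q. actr q x) Q (uce M)}"
      using mn by (simp add: lin_def actr_gen)
  qed (rule sub[OF lin_actr])
  then show "lin (\<lambda>q. actr q x) Q (uce M)" by simp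
qed

text \<open>The origin of the formula for \<open>actl\<close>: on a generator this is the relation
  of \<open>uce G\<close> at s q, t m, t n. Read from right to left, it puts mixed generators into
  the image of \<tau>.\<close>

lemma \<tau>_actl: "q \<in> carr Q \<Longrightarrow> x \<in> carr (uce M) \<Longrightarrow> \<tau> (actl q x) = gen G (s q) (t (Uce M x))"
  by (rule M.uce_lin_eqI[OF _ lin_comp[OF lin_actl t.lin_uce_map]
      lin_comp[OF M.lin_Uce lin_comp[OF t.lin_g G.lin_gen(1)]]])
    (use G.gen_leibniz[of "s q"] in \<open>simp_all add: actl_gen lin_simps[OF t.lin_uce_map] t_D t.g_brk t.g_alp alp_s\<close>)

text \<open>The relation at t m, t n, s q, solved for {[t m, t n], s q}, after symmetry has turned
  [t n, s q] and [t m, s q] around.\<close>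

lemma \<tau>_actr: "q \<in> carr Q \<Longrightarrow> x \<in> carr (uce M) \<Longrightarrow> \<tau> (actr q x) = gen G (t (Uce M x)) (s q)"
proof (rule M.uce_lin_eqI[OF _ lin_comp[OF lin_actr t.lin_uce_map]
      lin_comp[OF M.lin_Uce lin_comp[OF t.lin_g G.lin_gen(2)]]])
  fix m n assume q: "q \<in> carr Q" and mn: "m \<in> carr M" "n \<in> carr M"
  show "\<tau> (actr q (gen M m n)) = gen G (t (Uce M (gen M m n))) (s q)"
  proof (rule vs_eqI[OF G.vs_uce])
    fix \<phi> assume \<phi>: "lin \<phi> (uce G) scal"
    have "- \<phi> (gen G (alp G (t m)) (brk G (s q) (t n))) =
        \<phi> (gen G (brk G (t m) (t n)) (s q)) + \<phi> (gen G (brk G (s q) (t m)) (alp G (t n)))"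
      using q mn arg_cong[OF G.gen_leibniz[of "t m" "t n" "s q"], of \<phi>]
      by (simp add: alp_s brk_t_s G.gen_simps' functional_simps[OF \<phi>])
    moreover have "\<phi> (\<tau> (actr q (gen M m n))) =
        - \<phi> (gen G (brk G (s q) (t m)) (alp G (t n))) - \<phi> (gen G (alp G (t m)) (brk G (s q) (t n)))"
      using q mn by (simp add: actr_gen lin_simps[OF t.lin_uce_map] t_D t_simps t.g_alp
        G.gen_simps' functional_simps[OF \<phi>])
    ultimately have "\<phi> (\<tau> (actr q (gen M m n))) = \<phi> (gen G (brk G (t m) (t n)) (s q))" by algebra
    then show "\<phi> (\<tau> (actr q (gen M m n))) = \<phi> (gen G (t (Uce M (gen M m n))) (s q))"
      using mn by (simp add: t.g_brk)
  qed (use q mn in simp_all)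
qed simp_all

lemma Uce_actl: "q \<in> carr Q \<Longrightarrow> x \<in> carr (uce M) \<Longrightarrow> Uce M (actl q x) = D q (Uce M x)"
  by (rule M.uce_lin_eqI[OF _ lin_comp[OF lin_actl M.lin_Uce] lin_comp[OF M.lin_Uce lin_D(1)]])
    (simp_all add: actl_gen D_brk lin_simps[OF M.lin_Uce])

text \<open>Computed in G: by \<open>\<tau>_actr\<close> both sides have image [t (Uce M x), s q]
  under t, up to symmetry.\<close>

lemma Uce_actr: "q \<in> carr Q \<Longrightarrow> x \<in> carr (uce M) \<Longrightarrow> Uce M (actr q x) = neg M (D q (Uce M x))"
proof (rule t_eqI)
  assume "q \<in> carr Q" "x \<in> carr (uce M)"
  then show "t (Uce M (actr q x)) = t (neg M (D q (Uce M x)))"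
    by (subst t.Uce_uce_map[symmetric]) (simp_all add: \<tau>_actr t_simps t_D brk_t_s)
qed simp_all

lemma alp_actl: "q \<in> carr Q \<Longrightarrow> x \<in> carr (uce M) \<Longrightarrow> alp (uce M) (actl q x) = actl q (alp (uce M) x)"
  by (rule M.uce_lin_eqI[OF _ lin_comp[OF lin_actl M.lin_alp_uce] lin_comp[OF M.lin_alp_uce lin_actl]])
    (simp_all add: actl_gen lin_simps[OF M.lin_alp_uce] alp_D)

lemma alp_actr: "q \<in> carr Q \<Longrightarrow> x \<in> carr (uce M) \<Longrightarrow> alp (uce M) (actr q x) = actr q (alp (uce M) x)"
  by (rule M.uce_lin_eqI[OF _ lin_comp[OF lin_actr M.lin_alp_uce] lin_comp[OF M.lin_alp_uce lin_actr]])
    (simp_all add: actr_gen lin_simps[OF M.lin_alp_uce] lin_simps[OF M.lin_alp] alp_D)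

text \<open>\<open>\<tau>\<close> is not injective, so the action axioms cannot be pulled back from \<open>uce G\<close> and are checked on generators.\<close>

lemma actr_comm:
  assumes q: "q \<in> carr Q" "q' \<in> carr Q" and x: "x \<in> carr (uce M)"
  shows "actr (brk Q q q') (alp (uce M) x) = mns (uce M) (actr q' (actr q x)) (actr q (actr q' x))"
proof (rule M.uce_lin_eqI[OF x lin_comp[OF M.lin_alp_uce lin_actr]
      lin_mns_fun[OF lin_comp[OF lin_actr lin_actr] lin_comp[OF lin_actr lin_actr]]])
  fix m n assume mn: "m \<in> carr M" "n \<in> carr M"
  show "actr (brk Q q q') (alp (uce M) (gen M m n)) =
    mns (uce M) (actr q' (actr q (gen M m n))) (actr q (actr q' (gen M m n)))"
  proof (rule vs_eqI[OF M.vs_uce])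
    fix \<phi> assume \<phi>: "lin \<phi> (uce M) scal"
    show "\<phi> (actr (brk Q q q') (alp (uce M) (gen M m n))) =
      \<phi> (mns (uce M) (actr q' (actr q (gen M m n))) (actr q (actr q' (gen M m n))))"
      using q mn
      by (simp add: actr_gen actr_simps functional_simps[OF \<phi>] D_comm alp_D D_lin_simps M.gen_simps M.gen_simps'
        algebra_simps)
  qed (use q mn in simp_all)
qed (use q in simp_all)

lemma actl_actl:
  assumes q: "q \<in> carr Q" "q' \<in> carr Q" and x: "x \<in> carr (uce M)"
  shows "actl q (actl q' x) = mns (uce M) (actl (brk Q q q') (alp (uce M) x)) (actr q' (actl q x))"
proof (rule M.uce_lin_eqI[OF x lin_comp[OF lin_actl lin_actl]
      lin_mns_fun[OF lin_comp[OF M.lin_alp_uce lin_actl] lin_comp[OF lin_actl lin_actr]]])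
  fix m n assume mn: "m \<in> carr M" "n \<in> carr M"
  show "actl q (actl q' (gen M m n)) =
    mns (uce M) (actl (brk Q q q') (alp (uce M) (gen M m n))) (actr q' (actl q (gen M m n)))"
  proof (rule vs_eqI[OF M.vs_uce])
    fix \<phi> assume \<phi>: "lin \<phi> (uce M) scal"
    show "\<phi> (actl q (actl q' (gen M m n))) =
      \<phi> (mns (uce M) (actl (brk Q q q') (alp (uce M) (gen M m n))) (actr q' (actl q (gen M m n))))"
      using q mn
      by (simp add: actl_gen actl_simps actr_gen actr_simps functional_simps[OF \<phi>] D_comm alp_D D_lin_simps
        M.gen_simps M.gen_simps' algebra_simps)
  qed (use q mn in simp_all)
qed (use q in simp_all)

lemma actl_actr:
  assumes q: "q \<in> carr Q" "q' \<in> carr Q" and x: "x \<in> carr (uce M)"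
  shows "actl q (actr q' x) = mns (uce M) (actr q' (actl q x)) (actl (brk Q q q') (alp (uce M) x))"
proof (rule M.uce_lin_eqI[OF x lin_comp[OF lin_actr lin_actl]
      lin_mns_fun[OF lin_comp[OF lin_actl lin_actr] lin_comp[OF M.lin_alp_uce lin_actl]]])
  fix m n assume mn: "m \<in> carr M" "n \<in> carr M"
  show "actl q (actr q' (gen M m n)) =
    mns (uce M) (actr q' (actl q (gen M m n))) (actl (brk Q q q') (alp (uce M) (gen M m n)))"
  proof (rule vs_eqI[OF M.vs_uce])
    fix \<phi> assume \<phi>: "lin \<phi> (uce M) scal"
    show "\<phi> (actl q (actr q' (gen M m n))) =
      \<phi> (mns (uce M) (actr q' (actl q (gen M m n))) (actl (brk Q q q') (alp (uce M) (gen M m n))))"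
      using q mn
      by (simp add: actl_gen actl_simps actr_gen actr_simps functional_simps[OF \<phi>] D_comm alp_D D_lin_simps
        M.gen_simps M.gen_simps' algebra_simps)
  qed (use q mn in simp_all)
qed (use q in simp_all)

lemma alp_uce_Q: "y \<in> carr (uce Q) \<Longrightarrow> alp (uce Q) y = y"
  by (rule Q.uce_lin_eqI[where g = "\<lambda>y. y", OF _ Q.lin_alp_uce]) (simp_all add: alp_Q lin_def)

text \<open>Axioms with two elements of \<open>uce Q\<close> are the commutation rules above, as
  \<alpha> is the identity there. Axioms with two elements of \<open>uce M\<close> involve a
  bracket, which is a generator by \<open>brk_uce\<close>, so they follow from the values of the
  actions on generators.\<close>

lemma hom_action_uce: "hom_action (uce Q) (uce M) (\<lambda>y. actl (Uce Q y)) (\<lambda>x y. actr (Uce Q y) x)"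
  unfolding hom_action_def
  by (intro conjI ballI lin_actl lin_actr lin_comp[OF Q.lin_Uce lin_act_left(1)] lin_comp[OF Q.lin_Uce lin_act_left(2)])
    (simp_all add: alp_uce_Q Q.Uce_brk actr_comm actl_actr actl_actl M.brk_uce actl_gen actr_gen Uce_actl Uce_actr
      M.Uce_alp alp_actl alp_actr M.gen_simps' mns_mns_left mns_mns_right)

end

section \<open>Subalgebras and semidirect products\<close>

lemma restr_simps [simp]:
  "carr (restr V A) = A" "zer (restr V A) = zer V" "pls (restr V A) = pls V" "smul (restr V A) = smul V"
  "brk (restr V A) = brk V" "alp (restr V A) = alp V" "neg (restr V A) = neg V" "mns (restr V A) = mns V"
  by (simp_all add: restr_def neg_def mns_def fun_eq_iff)

lemma sdp_simps [simp]:
  "carr (sdp M L al ar) = carr M \<times> carr L" "zer (sdp M L al ar) = (zer M, zer L)"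
  "pls (sdp M L al ar) (m, l) (m', l') = (pls M m m', pls L l l')"
  "smul (sdp M L al ar) c (m, l) = (smul M c m, smul L c l)"
  "brk (sdp M L al ar) (m, l) (m', l') =
    (pls M (pls M (brk M m m') (al (alp L l) m')) (ar m (alp L l')), brk L l l')"
  "alp (sdp M L al ar) (m, l) = (alp M m, alp L l)"
  by (simp_all add: sdp_def)

lemma hom_comp:
  assumes "hom f A B" "hom g B C" shows "hom (\<lambda>x. g (f x)) A C"
  using assms lin_closed[of f A B] by (auto simp: hom_def intro: lin_comp)

text \<open>With both actions read as brackets, the six action identities are instances of one
  Leibniz identity, and the two rules for \<alpha> are multiplicativity.\<close>

lemma hom_action_bracket:
  assumes "hom_leibniz L" and S: "hom_subalgebra L S" and T: "hom_ideal L T"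
  shows "hom_action (restr L S) (restr L T) (brk L) (brk L)"
proof -
  have L: "vs L" "\<And>x. x \<in> carr L \<Longrightarrow> lin (brk L x) L L" "\<And>y. y \<in> carr L \<Longrightarrow> lin (\<lambda>x. brk L x y) L L"
    "\<And>x y z. x \<in> carr L \<Longrightarrow> y \<in> carr L \<Longrightarrow> z \<in> carr L \<Longrightarrow>
       brk L (alp L x) (brk L y z) = mns L (brk L (brk L x y) (alp L z)) (brk L (brk L x z) (alp L y))"
    "\<And>x y. x \<in> carr L \<Longrightarrow> y \<in> carr L \<Longrightarrow> alp L (brk L x y) = brk L (alp L x) (alp L y)"
    using assms(1) unfolding hom_leibniz_def by meson+
  have S': "\<And>x. x \<in> S \<Longrightarrow> x \<in> carr L" and T': "\<And>x. x \<in> T \<Longrightarrow> x \<in> carr L"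
    using S T by (auto simp: hom_subalgebra_def hom_ideal_def subspace_def)
  have TI: "\<And>x y. x \<in> T \<Longrightarrow> y \<in> carr L \<Longrightarrow> brk L x y \<in> T" "\<And>x y. x \<in> T \<Longrightarrow> y \<in> carr L \<Longrightarrow> brk L y x \<in> T"
    using T by (auto simp: hom_ideal_def)
  show ?thesis
    unfolding hom_action_def
    by (intro conjI ballI)
      (simp_all add: lin_def S' T' TI L(4,5) lin_pls[OF L(2)] lin_pls[OF L(3)] lin_smul[OF L(2)] lin_smul[OF L(3)])
qed

lemma lin_add_scal: "lin f V scal \<Longrightarrow> lin g V scal \<Longrightarrow> lin (\<lambda>x. f x + g x) V scal"
  by (simp add: lin_def algebra_simps)

lemma lin_const_zer: "vs W \<Longrightarrow> lin (\<lambda>_. zer W) V W"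
  by (simp add: lin_def)

lemma (in perfect_hom_leibniz) hom_Uce: "hom (Uce L) (uce L) L"
  by (simp add: hom_def lin_Uce Uce_brk Uce_alp)

section \<open>The kernel of \<open>uce_map t\<close>\<close>

context symmetric_split_extension
begin

section \<open>Coordinates on G with respect to t(M) and s(Q)\<close>

lemma split_eqI:
  assumes "m \<in> carr M" "q \<in> carr Q" "m' \<in> carr M" "q' \<in> carr Q"
    and eq: "pls G (t m) (s q) = pls G (t m') (s q')"
  shows "m = m'" "q = q'"
proof -
  show q: "q = q'" using assms(1-4) arg_cong[OF eq, of p] by (simp add: p_simps p_t split)
  show "m = m'"
  proof (rule t_eqI[OF assms(1,3)], rule vs_eqI[OF G.vs_L])
    fix \<phi> assume \<phi>: "lin \<phi> G scal"
    show "\<phi> (t m) = \<phi> (t m')"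
      using assms(1-4) arg_cong[OF eq, of \<phi>] q by (simp add: functional_simps[OF \<phi>])
  qed (use assms in simp_all)
qed

text \<open>The M-coordinate of an element of G; its Q-coordinate is given by p.\<close>

definition mpart :: "'g \<Rightarrow> 'm" where
  "mpart g = the_inv_into (carr M) t (mns G g (s (p g)))"

lemma
  assumes g: "g \<in> carr G"
  shows mpart_closed [simp]: "mpart g \<in> carr M" and mpart_split: "pls G (t (mpart g)) (s (p g)) = g"
proof -
  have "p (mns G g (s (p g))) = zer Q"
    using g by (simp add: p_simps split mns_def)
  then have m: "mpart g \<in> carr M" "t (mpart g) = mns G g (s (p g))"
    using g t_the_inv[of "mns G g (s (p g))"] by (simp_all add: mpart_def)
  then show "mpart g \<in> carr M" by simp
  show "pls G (t (mpart g)) (s (p g)) = g"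
    by (rule vs_eqI[OF G.vs_L]) (use g m(1) in \<open>simp_all add: m(2) functional_simps\<close>)
qed

lemma mpart_eq:
  assumes "m \<in> carr M" "q \<in> carr Q"
  shows "mpart (pls G (t m) (s q)) = m" "p (pls G (t m) (s q)) = q"
  using assms split_eqI[OF _ _ assms mpart_split] by simp_all

lemma split_cases:
  assumes "g \<in> carr G"
  obtains m q where "m \<in> carr M" "q \<in> carr Q" "g = pls G (t m) (s q)"
  using assms mpart_split mpart_closed p.g_closed by metis

lemma lin_mpart: "lin mpart G M"
proof (rule linI)
  fix c g h assume "g \<in> carr G"
  then obtain m q where g: "m \<in> carr M" "q \<in> carr Q" "g = pls G (t m) (s q)" by (rule split_cases)
  have "smul G c g = pls G (t (smul M c m)) (s (smul Q c q))"
    using g by (simp add: t_simps s_simps smul_pls)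
  then show "mpart (smul G c g) = smul M c (mpart g)" using g by (simp add: mpart_eq)
  assume "h \<in> carr G"
  then obtain n r where h: "n \<in> carr M" "r \<in> carr Q" "h = pls G (t n) (s r)" by (rule split_cases)
  have "pls G g h = pls G (t (pls M m n)) (s (pls Q q r))"
    using g h by (simp add: t_simps s_simps pls_ac)
  then show "mpart (pls G g h) = pls M (mpart g) (mpart h)" using g h by (simp add: mpart_eq)
qed simp

lemma mpart_alp: "g \<in> carr G \<Longrightarrow> mpart (alp G g) = alp M (mpart g)"
  and p_alp: "g \<in> carr G \<Longrightarrow> p (alp G g) = p g"
proof -
  assume "g \<in> carr G"
  then obtain m q where g: "m \<in> carr M" "q \<in> carr Q" "g = pls G (t m) (s q)" by (rule split_cases)
  have "alp G g = pls G (t (alp M m)) (s q)"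
    using g by (simp add: lin_simps[OF G.lin_alp] t.g_alp alp_s)
  then show "mpart (alp G g) = alp M (mpart g)" "p (alp G g) = p g" using g by (simp_all add: mpart_eq)
qed

text \<open>The M-component of a semidirect product bracket; the last term is the right action,
  negative by symmetry.\<close>

lemma mpart_brk:
  assumes "g \<in> carr G" "h \<in> carr G"
  shows "mpart (brk G g h) =
    mns M (pls M (brk M (mpart g) (mpart h)) (D (p g) (mpart h))) (D (p h) (mpart g))"
proof -
  obtain m q where g: "m \<in> carr M" "q \<in> carr Q" "g = pls G (t m) (s q)"
    using assms(1) by (rule split_cases)
  obtain n r where h: "n \<in> carr M" "r \<in> carr Q" "h = pls G (t n) (s r)"
    using assms(2) by (rule split_cases)
  have "brk G g h = pls G (t (mns M (pls M (brk M m n) (D q n)) (D r m))) (s (brk Q q r))"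
    by (rule vs_eqI[OF G.vs_L])
      (use g h in \<open>simp_all add: functional_simps t_simps t_D t.g_brk s.g_brk G.brk_simps brk_t_s algebra_simps\<close>)
  then show ?thesis using g h by (simp add: mpart_eq)
qed

lemma Uce_M_cases:
  assumes "m \<in> carr M"
  obtains x where "x \<in> carr (uce M)" "m = Uce M x"
  using assms M.Uce_surj by blast

lemma Uce_Q_cases:
  assumes "q \<in> carr Q"
  obtains y where "y \<in> carr (uce Q)" "q = Uce Q y"
  using assms Q.Uce_surj by blast

text \<open>The subspace K, spanned as in the final statement. Since \<open>Uce Q\<close> is onto,
  acting by all \<open>y\<close> amounts to acting by all of Q.\<close>

definition act_ker :: "('m \<times> 'm \<Rightarrow> 'k) set set" where
  "act_ker = span_in (uce M)
     ({actl (Uce Q y) x | y x. y \<in> carr (uce Q) \<and> x \<in> ker (Uce M) (uce M) M} \<union>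
      {actr (Uce Q y) x | x y. x \<in> ker (Uce M) (uce M) M \<and> y \<in> carr (uce Q)})"

lemma subspace_act_ker: "subspace (uce M) act_ker"
  unfolding act_ker_def by (rule subspace_span) (auto simp: ker_def)

text \<open>By \<open>\<tau>_actl\<close> and \<open>\<tau>_actr\<close>, \<tau> sends the spanning
  elements to {s q, t 0} and {t 0, s q}.\<close>

lemma act_ker_in_ker_\<tau>: "act_ker \<subseteq> ker \<tau> (uce M) (uce G)"
  unfolding act_ker_def
  by (intro span_in_subset subspace_ker[OF t.lin_uce_map])
    (auto simp: ker_def \<tau>_actl \<tau>_actr t_simps G.gen_zer)

text \<open>A functional \<open>\<phi>\<close> on \<open>uce M\<close> vanishing on \<open>act_ker\<close> factors through \<open>\<tau>\<close>: the forms
  \<open>fl q m = \<phi> (q \<cdot> x)\<close> and \<open>fr q m = \<phi> (x \<cdot> q)\<close> do not depend on the lift \<open>x\<close> of \<open>m = Uce M x\<close>,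
  and \<open>b\<close> extends \<open>\<phi>\<close> to \<open>uce G\<close> by the values that \<open>\<tau>_actl\<close> and \<open>\<tau>_actr\<close> force on mixed generators.\<close>

lemma ker_\<tau>_in_act_ker:
  assumes x: "x \<in> carr (uce M)" and \<tau>x: "\<tau> x = zer (uce G)"
  shows "x \<in> act_ker"
proof (rule subspace_memI[OF M.vs_uce subspace_act_ker x])
  fix \<phi> assume \<phi>: "lin \<phi> (uce M) scal" and ker: "\<And>k. k \<in> act_ker \<Longrightarrow> \<phi> k = 0"
  note \<phi>_simps = functional_simps[OF \<phi> M.vs_uce]
  have kill: "\<phi> (actl q x) = 0 \<and> \<phi> (actr q x) = 0"
    if "q \<in> carr Q" "x \<in> carr (uce M)" "Uce M x = zer M" for q x
  proof -
    obtain y where "y \<in> carr (uce Q)" "q = Uce Q y" using \<open>q \<in> carr Q\<close> by (rule Uce_Q_cases)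
    then have "actl q x \<in> act_ker" "actr q x \<in> act_ker"
      unfolding act_ker_def using that by (auto simp: ker_def intro!: span_base)
    then show ?thesis using ker by blast
  qed
  define \<xi> where "\<xi> m = (SOME x. x \<in> carr (uce M) \<and> Uce M x = m)" for m
  have \<xi>: "\<xi> (Uce M x) \<in> carr (uce M) \<and> Uce M (\<xi> (Uce M x)) = Uce M x" if "x \<in> carr (uce M)" for x
    unfolding \<xi>_def by (rule someI[of _ x]) (use that in simp)
  define fl where "fl q m = \<phi> (actl q (\<xi> m))" for q m
  define fr where "fr q m = \<phi> (actr q (\<xi> m))" for q m
  have f_Uce: "fl q (Uce M x) = \<phi> (actl q x)" "fr q (Uce M x) = \<phi> (actr q x)"
    if q: "q \<in> carr Q" and x: "x \<in> carr (uce M)" for q x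
  proof -
    have "Uce M (mns (uce M) (\<xi> (Uce M x)) x) = zer M"
      using \<xi>[OF x] x by (simp add: lin_simps[OF M.lin_Uce] mns_def)
    then show "fl q (Uce M x) = \<phi> (actl q x)" "fr q (Uce M x) = \<phi> (actr q x)"
      using kill[OF q, of "mns (uce M) (\<xi> (Uce M x)) x"] \<xi>[OF x] x q
      by (simp_all add: fl_def fr_def actl_simps actr_simps \<phi>_simps)
  qed
  have lin_fl: "lin (fl q) M scal" and lin_fr: "lin (fr q) M scal" if q: "q \<in> carr Q" for q
  proof -
    \<comment> \<open>The section \<xi> need not be linear. Since any lift may be used, a sum is
      evaluated at the sum of two lifts.\<close>
    have *: "lin f M scal"
      if f: "\<And>x. x \<in> carr (uce M) \<Longrightarrow> f (Uce M x) = g x" and g: "lin g (uce M) scal" for f and g :: "_ \<Rightarrow> 'k"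
    proof (rule linI)
      fix c m n assume "m \<in> carr M"
      then obtain x where x: "x \<in> carr (uce M)" "m = Uce M x" by (rule Uce_M_cases)
      have "smul M c m = Uce M (smul (uce M) c x)" using x by (simp add: lin_simps[OF M.lin_Uce])
      then show "f (smul M c m) = smul scal c (f m)" using x f by (simp add: functional_simps[OF g])
      assume "n \<in> carr M"
      then obtain y where y: "y \<in> carr (uce M)" "n = Uce M y" by (rule Uce_M_cases)
      have "pls M m n = Uce M (pls (uce M) x y)" using x y by (simp add: lin_simps[OF M.lin_Uce])
      then show "f (pls M m n) = pls scal (f m) (f n)" using x y f by (simp add: functional_simps[OF g])
    qed simp
    show "lin (fl q) M scal" by (rule *[OF f_Uce(1)[OF q] lin_comp[OF lin_actl[OF q] \<phi>]])
    show "lin (fr q) M scal" by (rule *[OF f_Uce(2)[OF q] lin_comp[OF lin_actr[OF q] \<phi>]])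
  qed
  have lin_fl': "lin (\<lambda>q. fl q m) Q scal" and lin_fr': "lin (\<lambda>q. fr q m) Q scal" if "m \<in> carr M" for m
  proof -
    obtain x where x: "x \<in> carr (uce M)" "m = Uce M x" using \<open>m \<in> carr M\<close> by (rule Uce_M_cases)
    show "lin (\<lambda>q. fl q m) Q scal" "lin (\<lambda>q. fr q m) Q scal"
      using lin_comp[OF lin_act_left(1) \<phi>, of x] lin_comp[OF lin_act_left(2) \<phi>, of x] x
      by (simp_all add: lin_def f_Uce)
  qed
  have f_brk: "fl q (brk M m n) = \<phi> (gen M (D q m) (alp M n)) - \<phi> (gen M (D q n) (alp M m))"
    "fr q (brk M m n) = - \<phi> (gen M (D q m) (alp M n)) - \<phi> (gen M (alp M m) (D q n))"
    if "q \<in> carr Q" "m \<in> carr M" "n \<in> carr M" for q m n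
    using that f_Uce[of q "gen M m n"] by (simp_all add: actl_gen actr_gen \<phi>_simps M.gen_simps')
  \<comment> \<open>Shadows of \<open>actr_comm\<close> and \<open>actl_actl\<close> under \<phi>;
    the signs come from \<open>Uce_actr\<close>, by which acting on the right applies -D to the
    argument in M.\<close>
  have fr_comm: "fr (brk Q q q') (alp M m) = fr q (D q' m) - fr q' (D q m)"
    and fl_D: "fl q (D q' m) = fl (brk Q q q') (alp M m) - fr q' (D q m)"
    if q: "q \<in> carr Q" "q' \<in> carr Q" and "m \<in> carr M" for q q' m
  proof -
    obtain x where x: "x \<in> carr (uce M)" "m = Uce M x" using \<open>m \<in> carr M\<close> by (rule Uce_M_cases)
    have neg: "\<phi> (actr r (actr r' x)) = - fr r (D r' m)" if "r \<in> carr Q" "r' \<in> carr Q" for r r'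
      using that x f_Uce(2)[of r "actr r' x"]
      by (simp add: Uce_actr functional_simps[OF lin_fr])
    show "fr (brk Q q q') (alp M m) = fr q (D q' m) - fr q' (D q m)"
      using q x f_Uce(2)[of "brk Q q q'" "alp (uce M) x"]
      by (simp add: M.Uce_alp actr_comm \<phi>_simps neg)
    show "fl q (D q' m) = fl (brk Q q q') (alp M m) - fr q' (D q m)"
      using q x f_Uce(1)[of q "actl q' x"] f_Uce(1)[of "brk Q q q'" "alp (uce M) x"] f_Uce(2)[of q' "actl q x"]
      by (simp add: M.Uce_alp Uce_actl actl_actl \<phi>_simps)
  qed
  \<comment> \<open>The bilinear expansion over {t m + s q, t n + s r}: the first term is \<phi>
    itself, the next two are the forced mixed values, and {s q, s r} contributes 0.\<close>
  define b where "b g h = \<phi> (gen M (mpart g) (mpart h)) + (fr (p h) (mpart g) + fl (p g) (mpart h))" for g h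
  have b: "G.leibniz_map scal b"
    unfolding G.leibniz_map_def
  proof (intro conjI ballI)
    fix g assume g: "g \<in> carr G"
    show "lin (b g) G scal" unfolding b_def
      using g by (intro lin_add_scal lin_comp[OF lin_mpart lin_comp[OF M.lin_gen(1) \<phi>]]
        lin_comp[OF p.lin_g lin_fr'] lin_comp[OF lin_mpart lin_fl]) simp_all
    show "lin (\<lambda>h. b h g) G scal" unfolding b_def
      using g by (intro lin_add_scal lin_comp[OF lin_mpart lin_comp[OF M.lin_gen(2) \<phi>]]
        lin_comp[OF p.lin_g lin_fl'] lin_comp[OF lin_mpart lin_fr]) simp_all
    fix h k assume h: "h \<in> carr G" and k: "k \<in> carr G"
    show "b (alp G g) (brk G h k) = mns scal (b (brk G g h) (alp G k)) (b (brk G g k) (alp G h))"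
      \<comment> \<open>Sorted by the number of arguments from Q, the trilinear identity splits as
        follows: none is the relation of \<open>uce M\<close>, one is \<open>f_brk\<close>, two is
        \<open>fr_comm\<close> or \<open>fl_D\<close>, and three gives 0 on both sides.\<close>
      using g h k
      by (simp add: b_def mpart_alp p_alp mpart_brk p.g_brk M.gen_simps M.gen_leibniz \<phi>_simps
        functional_simps[OF lin_fl] functional_simps[OF lin_fr] f_brk fr_comm fl_D)
  qed
  have zero: "fl (zer Q) m = 0" "fr (zer Q) m = 0" if "m \<in> carr M" for m
    using functional_simps(1)[OF lin_fl'[OF that]] functional_simps(1)[OF lin_fr'[OF that]] by simp_all
  have mpart_t: "mpart (t m) = m" if "m \<in> carr M" for m
    using mpart_eq(1)[OF that, of "zer Q"] that by (simp add: s_simps)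
  \<comment> \<open>On t(M) the Q-coordinate is 0, so only the \<phi>-term of \<open>b\<close>
    survives on generators.\<close>
  have "lift scal b (\<tau> x) = \<phi> x"
    by (rule M.uce_lin_eqI[OF x lin_comp[OF t.lin_uce_map G.lin_lift[OF b]] \<phi>])
      (simp_all add: G.lift_gen[OF b] b_def mpart_t p_t zero)
  then show "\<phi> x = 0" using \<tau>x functional_simps(1)[OF G.lin_lift[OF b]] by simp
qed

lemma ker_\<tau>: "ker \<tau> (uce M) (uce G) = act_ker"
  using act_ker_in_ker_\<tau> ker_\<tau>_in_act_ker by (auto simp: ker_def)

end

section \<open>Decomposition of \<open>uce G\<close>\<close>

context symmetric_split_extension
begin

lemmas \<tau>_simps = lin_simps[OF t.lin_uce_map] lin_zer[OF t.lin_uce_map M.vs_uce G.vs_uce]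
lemmas \<sigma>_simps = lin_simps[OF s.lin_uce_map] lin_zer[OF s.lin_uce_map Q.vs_uce G.vs_uce]
lemmas \<pi>_simps = lin_simps[OF p.lin_uce_map] lin_zer[OF p.lin_uce_map G.vs_uce Q.vs_uce]

lemma \<pi>_\<tau>: "x \<in> carr (uce M) \<Longrightarrow> \<pi> (\<tau> x) = zer (uce Q)"
  by (rule M.uce_lin_eqI[OF _ lin_comp[OF t.lin_uce_map p.lin_uce_map] lin_const_zer[OF Q.vs_uce]])
    (simp_all add: p_t Q.gen_zer)

lemma \<pi>_\<sigma>: "y \<in> carr (uce Q) \<Longrightarrow> \<pi> (\<sigma> y) = y"
  by (rule Q.uce_lin_eqI[where g = "\<lambda>y. y", OF _ lin_comp[OF s.lin_uce_map p.lin_uce_map]])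
    (simp_all add: split lin_def)

lemma \<pi>_sum: "x \<in> carr (uce M) \<Longrightarrow> y \<in> carr (uce Q) \<Longrightarrow> \<pi> (pls (uce G) (\<tau> x) (\<sigma> y)) = y"
  by (simp add: \<pi>_simps \<pi>_\<tau> \<pi>_\<sigma>)

lemma uce_G_cases:
  assumes "X \<in> carr (uce G)"
  obtains x y where "x \<in> carr (uce M)" "y \<in> carr (uce Q)" "X = pls (uce G) (\<tau> x) (\<sigma> y)"
proof -
  let ?A = "{pls (uce G) (\<tau> x) (\<sigma> y) | x y. x \<in> carr (uce M) \<and> y \<in> carr (uce Q)}"
  have "X \<in> ?A" using assms
  proof (rule G.uce_induct)
    show "subspace (uce G) ?A"
      unfolding subspace_def
    proof (intro conjI ballI allI)
      show "?A \<subseteq> carr (uce G)" by auto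
      have "zer (uce G) = pls (uce G) (\<tau> (zer (uce M))) (\<sigma> (zer (uce Q)))" by (simp add: \<tau>_simps \<sigma>_simps)
      then show "zer (uce G) \<in> ?A" using vs_zer[OF M.vs_uce] vs_zer[OF Q.vs_uce] by blast
    next
      fix c X assume "X \<in> ?A"
      then obtain x y where X: "x \<in> carr (uce M)" "y \<in> carr (uce Q)" "X = pls (uce G) (\<tau> x) (\<sigma> y)" by blast
      then have "smul (uce G) c X = pls (uce G) (\<tau> (smul (uce M) c x)) (\<sigma> (smul (uce Q) c y))"
        by (simp add: \<tau>_simps \<sigma>_simps smul_pls)
      then show "smul (uce G) c X \<in> ?A" using vs_smul[OF M.vs_uce X(1)] vs_smul[OF Q.vs_uce X(2)] by blast
    next
      fix X Y assume "X \<in> ?A" "Y \<in> ?A"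
      then obtain x y x' y' where X: "x \<in> carr (uce M)" "y \<in> carr (uce Q)" "X = pls (uce G) (\<tau> x) (\<sigma> y)"
        and Y: "x' \<in> carr (uce M)" "y' \<in> carr (uce Q)" "Y = pls (uce G) (\<tau> x') (\<sigma> y')" by blast
      then have "pls (uce G) X Y = pls (uce G) (\<tau> (pls (uce M) x x')) (\<sigma> (pls (uce Q) y y'))"
        by (simp add: \<tau>_simps \<sigma>_simps pls_ac)
      then show "pls (uce G) X Y \<in> ?A" using vs_pls[OF M.vs_uce X(1) Y(1)] vs_pls[OF Q.vs_uce X(2) Y(2)] by blast
    qed
  next
    fix g h assume g: "g \<in> carr G" and h: "h \<in> carr G"
    obtain m q where m: "m \<in> carr M" "q \<in> carr Q" "g = pls G (t m) (s q)" using g by (rule split_cases)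
    obtain n r where n: "n \<in> carr M" "r \<in> carr Q" "h = pls G (t n) (s r)" using h by (rule split_cases)
    obtain x where x: "x \<in> carr (uce M)" "m = Uce M x" using m(1) by (rule Uce_M_cases)
    obtain y where y: "y \<in> carr (uce M)" "n = Uce M y" using n(1) by (rule Uce_M_cases)
    \<comment> \<open>M-part of the expansion of {t m + s q, t n + s r}. The lifts \<open>x\<close>
      and \<open>y\<close> of \<open>m\<close> and \<open>n\<close> are needed because
      \<open>\<tau>_actl\<close> and \<open>\<tau>_actr\<close> produce mixed generators whose
      M-entry is a value of \<open>Uce M\<close>.\<close>
    let ?x = "pls (uce M) (gen M m n) (pls (uce M) (actl q y) (actr r x))"
    have "gen G g h = pls (uce G) (\<tau> ?x) (\<sigma> (gen Q q r))"
      using m n x y by (simp add: \<tau>_simps \<tau>_actl \<tau>_actr G.gen_simps pls_ac)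
    moreover have "?x \<in> carr (uce M)" "gen Q q r \<in> carr (uce Q)" using m n x y by simp_all
    ultimately show "gen G g h \<in> ?A" by blast
  qed
  then show ?thesis using that by blast
qed

lemma sum_eq_zer:
  assumes "x \<in> carr (uce M)" "y \<in> carr (uce Q)"
  shows "pls (uce G) (\<tau> x) (\<sigma> y) = zer (uce G) \<longleftrightarrow> \<tau> x = zer (uce G) \<and> y = zer (uce Q)"
proof
  assume z: "pls (uce G) (\<tau> x) (\<sigma> y) = zer (uce G)"
  then have "y = zer (uce Q)" using \<pi>_sum[OF assms] by (simp add: \<pi>_simps)
  then show "\<tau> x = zer (uce G) \<and> y = zer (uce Q)" using z assms by (simp add: \<sigma>_simps)
qed (use assms in \<open>simp add: \<sigma>_simps\<close>)

lemma image_\<tau>: "\<tau> ` carr (uce M) = ker \<pi> (uce G) (uce Q)"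
proof
  show "\<tau> ` carr (uce M) \<subseteq> ker \<pi> (uce G) (uce Q)" by (auto simp: ker_def \<pi>_\<tau>)
  show "ker \<pi> (uce G) (uce Q) \<subseteq> \<tau> ` carr (uce M)"
  proof
    fix X assume X: "X \<in> ker \<pi> (uce G) (uce Q)"
    then have "X \<in> carr (uce G)" by (simp add: ker_def)
    then obtain x y where "x \<in> carr (uce M)" "y \<in> carr (uce Q)" "X = pls (uce G) (\<tau> x) (\<sigma> y)"
      by (rule uce_G_cases)
    then show "X \<in> \<tau> ` carr (uce M)" using X by (auto simp: ker_def \<pi>_sum \<sigma>_simps)
  qed
qed

text \<open>The image is treated as Ker \<pi>. A bracket with one factor there becomes {0, _} or {_,
  0} under \<pi>, since brackets of \<open>uce Q\<close> depend only on
  \<open>Uce Q\<close>.\<close>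

lemma hom_ideal_\<tau>: "hom_ideal (uce G) (\<tau> ` carr (uce M))"
proof -
  have "\<pi> (alp (uce G) X) = zer (uce Q)" if "X \<in> carr (uce G)" "\<pi> X = zer (uce Q)" for X
    using p.hom_uce_map that lin_zer[OF Q.lin_alp_uce] by (simp add: hom_def)
  moreover have "\<pi> (brk (uce G) X Y) = zer (uce Q) \<and> \<pi> (brk (uce G) Y X) = zer (uce Q)"
    if "X \<in> carr (uce G)" "\<pi> X = zer (uce Q)" "Y \<in> carr (uce G)" for X Y
    using that lin_zer[OF Q.lin_Uce] by (simp add: p.uce_map_brk Q.brk_uce Q.gen_zer)
  moreover have "brk (uce G) X Y \<in> carr (uce G)" if "X \<in> carr (uce G)" "Y \<in> carr (uce G)" for X Y
    using that by (simp add: G.brk_uce)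
  ultimately show ?thesis
    unfolding hom_ideal_def image_\<tau> using subspace_ker[OF p.lin_uce_map]
    by (auto simp: ker_def)
qed

lemma alp_\<sigma>: "y \<in> carr (uce Q) \<Longrightarrow> alp (uce G) (\<sigma> y) = \<sigma> y"
  using s.hom_uce_map alp_uce_Q[of y] unfolding hom_def by force

lemma alp_\<tau>: "x \<in> carr (uce M) \<Longrightarrow> alp (uce G) (\<tau> x) = \<tau> (alp (uce M) x)"
  using t.hom_uce_map by (simp add: hom_def)

lemma subspace_\<sigma>: "subspace (uce G) (\<sigma> ` carr (uce Q))"
  by (intro subspace_image[OF s.lin_uce_map] subspace_carrier) simp_all

lemma subspace_\<tau>: "subspace (uce G) (\<tau> ` carr (uce M))"
  by (intro subspace_image[OF t.lin_uce_map] subspace_carrier) simp_all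

lemma brk_uce_Q_closed [simp]:
  "y \<in> carr (uce Q) \<Longrightarrow> z \<in> carr (uce Q) \<Longrightarrow> brk (uce Q) y z \<in> carr (uce Q)"
  by (simp add: Q.brk_uce)

lemma hom_subalgebra_\<sigma>: "hom_subalgebra (uce G) (\<sigma> ` carr (uce Q))"
  unfolding hom_subalgebra_def
  by (auto simp: subspace_\<sigma> alp_\<sigma> simp flip: s.uce_map_brk)

lemma dsum_uce: "dsum (uce G) (\<tau> ` carr (uce M)) (\<sigma> ` carr (uce Q)) (carr (uce G))"
  unfolding dsum_def
proof
  show "carr (uce G) = {pls (uce G) a b |a b. a \<in> \<tau> ` carr (uce M) \<and> b \<in> \<sigma> ` carr (uce Q)}"
    by (auto elim!: uce_G_cases)
  show "\<tau> ` carr (uce M) \<inter> \<sigma> ` carr (uce Q) = {zer (uce G)}"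
  proof
    show "\<tau> ` carr (uce M) \<inter> \<sigma> ` carr (uce Q) \<subseteq> {zer (uce G)}"
    proof
      fix X assume "X \<in> \<tau> ` carr (uce M) \<inter> \<sigma> ` carr (uce Q)"
      then obtain x y where "x \<in> carr (uce M)" "y \<in> carr (uce Q)" and X: "X = \<tau> x" "X = \<sigma> y" by auto
      then have "y = zer (uce Q)" using \<pi>_\<tau>[of x] \<pi>_\<sigma>[of y] by simp
      then show "X \<in> {zer (uce G)}" using X by (simp add: \<sigma>_simps)
    qed
    show "{zer (uce G)} \<subseteq> \<tau> ` carr (uce M) \<inter> \<sigma> ` carr (uce Q)"
      using subspace_\<tau> subspace_\<sigma> by (simp add: subspace_def)
  qed
qed

lemma iso_bracket_sdp:
  "iso (\<lambda>(x, y). pls (uce G) x y)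
    (sdp (restr (uce G) (\<tau> ` carr (uce M))) (restr (uce G) (\<sigma> ` carr (uce Q))) (brk (uce G)) (brk (uce G))) (uce G)"
    (is "iso ?f ?E _")
  unfolding iso_def
proof
  show "hom ?f ?E (uce G)"
    unfolding hom_def
  proof (intro conjI ballI)
    show "lin ?f ?E (uce G)"
      by (rule linI) (auto simp: \<tau>_simps \<sigma>_simps pls_ac smul_pls)
    fix X assume "X \<in> carr ?E"
    then obtain x y where X: "x \<in> carr (uce M)" "y \<in> carr (uce Q)" "X = (\<tau> x, \<sigma> y)" by auto
    show "?f (alp ?E X) = alp (uce G) (?f X)"
      using X by (simp add: lin_simps[OF G.lin_alp_uce])
    fix Y assume "Y \<in> carr ?E"
    then obtain x' y' where Y: "x' \<in> carr (uce M)" "y' \<in> carr (uce Q)" "Y = (\<tau> x', \<sigma> y')" by auto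
    \<comment> \<open>On the second factor \<alpha> is the identity, so the twists in the semidirect
      bracket disappear and bilinear expansion remains.\<close>
    show "?f (brk ?E X Y) = brk (uce G) (?f X) (?f Y)"
      using X Y by (simp add: alp_\<sigma> G.brk_uce lin_simps[OF G.lin_Uce] G.gen_simps pls_ac)
  qed
  show "bij_betw ?f (carr ?E) (carr (uce G))"
    unfolding bij_betw_def
  proof
    show "?f ` carr ?E = carr (uce G)"
      using dsum_uce unfolding dsum_def by (auto simp: image_iff)
    show "inj_on ?f (carr ?E)"
    proof (rule inj_onI)
      fix X Y assume "X \<in> carr ?E" "Y \<in> carr ?E" and eq: "?f X = ?f Y"
      then obtain x y x' y' where X: "x \<in> carr (uce M)" "y \<in> carr (uce Q)" "X = (\<tau> x, \<sigma> y)"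
        and Y: "x' \<in> carr (uce M)" "y' \<in> carr (uce Q)" "Y = (\<tau> x', \<sigma> y')" by auto
      have y: "y = y'" using arg_cong[OF eq, of \<pi>] X Y by (simp add: \<pi>_sum)
      have "\<tau> x = \<tau> x'"
      proof (rule vs_eqI[OF G.vs_uce])
        fix \<phi> assume \<phi>: "lin \<phi> (uce G) scal"
        show "\<phi> (\<tau> x) = \<phi> (\<tau> x')"
          using arg_cong[OF eq, of \<phi>] X Y y by (simp add: functional_simps[OF \<phi>])
      qed (use X Y in simp_all)
      then show "X = Y" using X Y y by simp
    qed
  qed
qed

lemma iso_\<sigma>: "iso \<sigma> (uce Q) (restr (uce G) (\<sigma> ` carr (uce Q)))"
proof -
  have "hom \<sigma> (uce Q) (restr (uce G) (\<sigma> ` carr (uce Q)))"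
    using s.hom_uce_map by (simp add: hom_def lin_def)
  moreover have "inj_on \<sigma> (carr (uce Q))" by (rule inj_on_inverseI[where g = \<pi>]) (rule \<pi>_\<sigma>)
  ultimately show ?thesis by (simp add: iso_def bij_betw_def)
qed

section \<open>The map to G on the decomposition\<close>

lemma Uce_sum: "x \<in> carr (uce M) \<Longrightarrow> y \<in> carr (uce Q) \<Longrightarrow>
    Uce G (pls (uce G) (\<tau> x) (\<sigma> y)) = pls G (t (Uce M x)) (s (Uce Q y))"
  by (simp add: lin_simps[OF G.lin_Uce] t.Uce_uce_map s.Uce_uce_map)

text \<open>Uniqueness of the coordinates in G decouples the two conditions; this yields both kernel
  descriptions that involve \<open>HL2 Q\<close>.\<close>

lemma Uce_sum_eq_zer:
  assumes "x \<in> carr (uce M)" "y \<in> carr (uce Q)"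
  shows "Uce G (pls (uce G) (\<tau> x) (\<sigma> y)) = zer G \<longleftrightarrow> Uce M x = zer M \<and> Uce Q y = zer Q"
proof
  assume "Uce G (pls (uce G) (\<tau> x) (\<sigma> y)) = zer G"
  then have "pls G (t (Uce M x)) (s (Uce Q y)) = pls G (t (zer M)) (s (zer Q))"
    using assms by (simp add: Uce_sum t_simps s_simps)
  then show "Uce M x = zer M \<and> Uce Q y = zer Q"
    using assms split_eqI[of "Uce M x" "Uce Q y" "zer M" "zer Q"] by simp
qed (use assms in \<open>simp add: Uce_sum t_simps s_simps\<close>)

lemma dsum_ker_Uce:
  "dsum (uce G) (\<tau> ` ker (Uce M) (uce M) M) (\<sigma> ` HL2 Q) (ker (Uce G) (uce G) G)"
  unfolding dsum_def
proof
  show "ker (Uce G) (uce G) G = {pls (uce G) a b |a b. a \<in> \<tau> ` ker (Uce M) (uce M) M \<and> b \<in> \<sigma> ` HL2 Q}"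
  proof (intro equalityI subsetI)
    fix X assume X: "X \<in> ker (Uce G) (uce G) G"
    then have "X \<in> carr (uce G)" by (simp add: ker_def)
    then obtain x y where xy: "x \<in> carr (uce M)" "y \<in> carr (uce Q)" "X = pls (uce G) (\<tau> x) (\<sigma> y)"
      by (rule uce_G_cases)
    then have "x \<in> ker (Uce M) (uce M) M" "y \<in> HL2 Q"
      using X Uce_sum_eq_zer[OF xy(1,2)] by (simp_all add: ker_def HL2_def)
    then show "X \<in> {pls (uce G) a b |a b. a \<in> \<tau> ` ker (Uce M) (uce M) M \<and> b \<in> \<sigma> ` HL2 Q}"
      using xy(3) by blast
  qed (auto simp: ker_def HL2_def Uce_sum_eq_zer)
  have "\<tau> ` ker (Uce M) (uce M) M \<inter> \<sigma> ` HL2 Q \<subseteq> {zer (uce G)}"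
    using dsum_uce unfolding dsum_def ker_def HL2_def by blast
  moreover have "zer (uce G) \<in> \<tau> ` ker (Uce M) (uce M) M" "zer (uce G) \<in> \<sigma> ` HL2 Q"
    using subspace_image[OF t.lin_uce_map _ _ subspace_ker[OF M.lin_Uce]]
      subspace_image[OF s.lin_uce_map _ _ subspace_ker[OF Q.lin_Uce]]
    by (simp_all add: HL2_def subspace_def)
  ultimately show "\<tau> ` ker (Uce M) (uce M) M \<inter> \<sigma> ` HL2 Q = {zer (uce G)}" by blast
qed

section \<open>The semidirect product of \<open>uce M\<close> by \<open>uce Q\<close>\<close>

abbreviation "E \<equiv> sdp (uce M) (uce Q) (\<lambda>y. actl (Uce Q y)) (\<lambda>x y. actr (Uce Q y) x)"

text \<open>The bracket of two images is a generator with two sums as entries. Its four bilinear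
  terms are the images of the four terms of the semidirect bracket, the mixed ones by
  \<open>\<tau>_actl\<close> and \<open>\<tau>_actr\<close>.\<close>

lemma hom_sum: "hom (\<lambda>(x, y). pls (uce G) (\<tau> x) (\<sigma> y)) E (uce G)"
  unfolding hom_def
proof (intro conjI ballI)
  show "lin (\<lambda>(x, y). pls (uce G) (\<tau> x) (\<sigma> y)) E (uce G)"
    by (rule linI) (auto simp: \<tau>_simps \<sigma>_simps pls_ac smul_pls)
  fix X assume "X \<in> carr E"
  then obtain x y where X: "x \<in> carr (uce M)" "y \<in> carr (uce Q)" "X = (x, y)" by auto
  then show "(\<lambda>(x, y). pls (uce G) (\<tau> x) (\<sigma> y)) (alp E X) = alp (uce G) ((\<lambda>(x, y). pls (uce G) (\<tau> x) (\<sigma> y)) X)"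
    by (simp add: lin_simps[OF G.lin_alp_uce] alp_\<tau> alp_\<sigma> alp_uce_Q)
  fix Y assume "Y \<in> carr E"
  then obtain x' y' where Y: "x' \<in> carr (uce M)" "y' \<in> carr (uce Q)" "Y = (x', y')" by auto
  have "\<tau> (brk (uce M) x x') = gen G (t (Uce M x)) (t (Uce M x'))"
    "\<sigma> (brk (uce Q) y y') = gen G (s (Uce Q y)) (s (Uce Q y'))"
    using X Y by (simp_all add: M.brk_uce Q.brk_uce)
  then show "(\<lambda>(x, y). pls (uce G) (\<tau> x) (\<sigma> y)) (brk E X Y) =
      brk (uce G) ((\<lambda>(x, y). pls (uce G) (\<tau> x) (\<sigma> y)) X) ((\<lambda>(x, y). pls (uce G) (\<tau> x) (\<sigma> y)) Y)"
    using X Y by (simp add: G.brk_uce M.brk_uce Uce_sum \<tau>_simps \<tau>_actl \<tau>_actr alp_uce_Q G.gen_simps pls_ac)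
qed

lemma image_sum: "(\<lambda>(x, y). pls (uce G) (\<tau> x) (\<sigma> y)) ` carr E = carr (uce G)"
  by (auto elim!: uce_G_cases simp: image_iff)

text \<open>Applying \<pi> forces the second component to vanish, which leaves the kernel of
  \<tau>.\<close>

lemma ker_sum: "ker (\<lambda>(x, y). pls (uce G) (\<tau> x) (\<sigma> y)) E (uce G) = act_ker \<times> {zer (uce Q)}"
  unfolding ker_\<tau>[symmetric] ker_def sdp_simps(1)
proof (intro set_eqI)
  fix X :: "('m \<times> 'm \<Rightarrow> 'k) set \<times> ('q \<times> 'q \<Rightarrow> 'k) set"
  obtain x y where X: "X = (x, y)" by (cases X)
  show "X \<in> {X \<in> carr (uce M) \<times> carr (uce Q). (\<lambda>(x, y). pls (uce G) (\<tau> x) (\<sigma> y)) X = zer (uce G)} \<longleftrightarrow>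
      X \<in> {x \<in> carr (uce M). \<tau> x = zer (uce G)} \<times> {zer (uce Q)}"
    unfolding X using sum_eq_zer[of x y] vs_zer[OF Q.vs_uce] by (simp, metis)
qed

lemma hom_Uce_sum: "hom (\<lambda>(x, y). Uce G (pls (uce G) (\<tau> x) (\<sigma> y))) E G"
  using hom_comp[OF hom_sum G.hom_Uce] by (simp add: case_prod_unfold)

lemma image_Uce_sum: "(\<lambda>(x, y). Uce G (pls (uce G) (\<tau> x) (\<sigma> y))) ` carr E = carr G"
proof -
  have "(\<lambda>(x, y). Uce G (pls (uce G) (\<tau> x) (\<sigma> y))) ` carr E =
      Uce G ` (\<lambda>(x, y). pls (uce G) (\<tau> x) (\<sigma> y)) ` carr E"
    by (simp only: image_image case_prod_unfold)
  then show ?thesis by (simp only: image_sum G.Uce_surj)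
qed

lemma ker_Uce_sum: "ker (\<lambda>(x, y). Uce G (pls (uce G) (\<tau> x) (\<sigma> y))) E G = ker (Uce M) (uce M) M \<times> HL2 Q"
  by (auto simp: ker_def HL2_def Uce_sum_eq_zer)

lemma act_gen:
  "\<forall>q1\<in>carr Q. \<forall>q2\<in>carr Q. \<forall>m1\<in>carr M. \<forall>m2\<in>carr M.
     actl (Uce Q (gen Q q1 q2)) (gen M (alp M m1) (alp M m2)) =
       mns (uce M) (gen M (D (brk Q q1 q2) (alp M m1)) (alp M (alp M m2)))
                   (gen M (D (brk Q q1 q2) (alp M m2)) (alp M (alp M m1))) \<and>
     actr (Uce Q (gen Q q1 q2)) (gen M (alp M m1) (alp M m2)) =
       mns (uce M) (gen M (ind_r M G t s (alp M m1) (brk Q q1 q2)) (alp M (alp M m2)))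
                   (gen M (alp M (alp M m1)) (D (brk Q q1 q2) (alp M m2)))"
  by (simp add: actl_gen actr_gen ind_r_eq)

lemma Uce_sum_gen:
  "\<forall>q1\<in>carr Q. \<forall>q2\<in>carr Q. \<forall>m1\<in>carr M. \<forall>m2\<in>carr M.
     (\<lambda>(x, y). Uce G (pls (uce G) (\<tau> x) (\<sigma> y))) (gen M (alp M m1) (alp M m2), gen Q q1 q2) =
       pls G (t (brk M (alp M m1) (alp M m2))) (s (brk Q q1 q2))"
  \<comment> \<open>The generator rules are removed because they would rewrite \<tau> and \<sigma>
    away before \<open>Uce_sum\<close> can match.\<close>
  by (simp add: Uce_sum del: t.uce_map_gen s.uce_map_gen)

end

theorem theorem5p2:
  fixes M :: "('k::field, 'm) hla" and G :: "('k, 'g) hla" and Q :: "('k, 'q) hla"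
    and t :: "'m \<Rightarrow> 'g" and p :: "'g \<Rightarrow> 'q" and s :: "'q \<Rightarrow> 'g"
  assumes hlM: "hom_leibniz M" and hlG: "hom_leibniz G" and hlQ: "hom_leibniz Q"
    and pM: "alpha_perfect M" and pG: "alpha_perfect G" and pQ: "alpha_perfect Q"
    and Qid: "\<forall>q\<in>carr Q. alp Q q = q"
    and ht: "hom t M G" and hp: "hom p G Q" and hs: "hom s Q G"
    and t_inj: "inj_on t (carr M)"
    and exact: "t ` carr M = ker p G Q"
    and p_surj: "p ` carr G = carr Q"
    and split: "\<forall>q\<in>carr Q. p (s q) = q"
    and symm: "\<forall>q\<in>carr Q. \<forall>m\<in>carr M. pls M (ind_l M G t s q m) (ind_r M G t s m q) = zer M"
  defines "\<tau> \<equiv> uce_map t M G" and "\<sigma> \<equiv> uce_map s Q G" and "\<pi> \<equiv> uce_map p G Q"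
    and "ql \<equiv> ind_l M G t s" and "qr \<equiv> ind_r M G t s"
    and "T \<equiv> uce_map t M G ` carr (uce M)" and "S \<equiv> uce_map s Q G ` carr (uce Q)"
    and "ts \<equiv> (\<lambda>(x, y). pls (uce G) (uce_map t M G x) (uce_map s Q G y))"
    and "\<Phi> \<equiv> (\<lambda>(x, y). Uce G (pls (uce G) (uce_map t M G x) (uce_map s Q G y)))"
  shows
    "(T = ker \<pi> (uce G) (uce Q) \<and>
      hom_ideal (uce G) T \<and>
      hom_subalgebra (uce G) S \<and>
      (\<forall>x\<in>S. alp (uce G) x = x) \<and>
      dsum (uce G) T S (carr (uce G)) \<and>
      hom_action (restr (uce G) S) (restr (uce G) T) (brk (uce G)) (brk (uce G)) \<and>
      (\<exists>f. iso f (sdp (restr (uce G) T) (restr (uce G) S) (brk (uce G)) (brk (uce G))) (uce G)))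
     \<and>
     iso \<sigma> (uce Q) (restr (uce G) S)
     \<and>
     dsum (uce G) (\<tau> ` ker (Uce M) (uce M) M) (\<sigma> ` HL2 Q) (ker (Uce G) (uce G) G)
     \<and>
     (\<exists>al ar.
        (\<forall>q1\<in>carr Q. \<forall>q2\<in>carr Q. \<forall>m1\<in>carr M. \<forall>m2\<in>carr M.
           al (gen Q q1 q2) (gen M (alp M m1) (alp M m2)) =
             mns (uce M) (gen M (ql (brk Q q1 q2) (alp M m1)) (alp M (alp M m2)))
                         (gen M (ql (brk Q q1 q2) (alp M m2)) (alp M (alp M m1))) \<and>
           ar (gen M (alp M m1) (alp M m2)) (gen Q q1 q2) =
             mns (uce M) (gen M (qr (alp M m1) (brk Q q1 q2)) (alp M (alp M m2)))
                         (gen M (alp M (alp M m1)) (ql (brk Q q1 q2) (alp M m2)))) \<and>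
        hom_action (uce Q) (uce M) al ar \<and>
        hom ts (sdp (uce M) (uce Q) al ar) (uce G) \<and>
        ts ` carr (sdp (uce M) (uce Q) al ar) = carr (uce G) \<and>
        hom \<Phi> (sdp (uce M) (uce Q) al ar) G \<and>
        \<Phi> ` carr (sdp (uce M) (uce Q) al ar) = carr G \<and>
        (\<forall>q1\<in>carr Q. \<forall>q2\<in>carr Q. \<forall>m1\<in>carr M. \<forall>m2\<in>carr M.
           \<Phi> (gen M (alp M m1) (alp M m2), gen Q q1 q2) =
             pls G (t (brk M (alp M m1) (alp M m2))) (s (brk Q q1 q2))) \<and>
        ker \<Phi> (sdp (uce M) (uce Q) al ar) G = ker (Uce M) (uce M) M \<times> HL2 Q \<and>
        ker ts (sdp (uce M) (uce Q) al ar) (uce G) =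
          span_in (uce M)
            ({al y x | y x. y \<in> carr (uce Q) \<and> x \<in> ker (Uce M) (uce M) M} \<union>
             {ar x y | x y. x \<in> ker (Uce M) (uce M) M \<and> y \<in> carr (uce Q)})
          \<times> {zer (uce Q)})"
proof -
  interpret symmetric_split_extension M G Q t p s
    using assms(1-16) by unfold_locales simp_all
  show ?thesis
    unfolding \<tau>_def \<sigma>_def \<pi>_def ql_def qr_def T_def S_def ts_def \<Phi>_def
  proof (intro conjI exI[of _ "\<lambda>y. actl (Uce Q y)"] exI[of _ "\<lambda>x y. actr (Uce Q y) x"])
    show "\<exists>f. iso f (sdp (restr (uce G) (uce_map t M G ` carr (uce M)))
        (restr (uce G) (uce_map s Q G ` carr (uce Q))) (brk (uce G)) (brk (uce G))) (uce G)"
      using iso_bracket_sdp by blast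
    show "hom_action (restr (uce G) (uce_map s Q G ` carr (uce Q)))
        (restr (uce G) (uce_map t M G ` carr (uce M))) (brk (uce G)) (brk (uce G))"
      by (intro hom_action_bracket G.hom_leibniz_uce hom_subalgebra_\<sigma> hom_ideal_\<tau>)
    show "\<forall>x\<in>uce_map s Q G ` carr (uce Q). alp (uce G) x = x" by (auto simp: alp_\<sigma>)
  qed (fact image_\<tau> hom_ideal_\<tau> hom_subalgebra_\<sigma> dsum_uce iso_\<sigma> dsum_ker_Uce act_gen hom_action_uce
      hom_sum image_sum hom_Uce_sum image_Uce_sum Uce_sum_gen ker_Uce_sum ker_sum[unfolded act_ker_def])+
qed

end
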